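(* Let $T \in \mathbb{F}^{n} \otimes \mathbb{F}^n \otimes\mathbb{F}^n$ be symmetric and concise. Then $\lim_{m\to\infty} Q(T^{\boxtimes m})^{1/m} \geq \sqrt{n}$.
   Context: $\mathbb{F}$ is any field. $T=\sum T_{i,j,k}e_i\otimes e_j\otimes e_k$ is symmetric if $T_{i_1,i_2,i_3}=T_{i_{\sigma(1)},i_{\sigma(2)},i_{\sigma(3)}}$ for all indices and all $\sigma\in S_3$. $T$ is concise if each of its three flattenings (grouping two tensor legs) has rank $n$. The subrank $Q(T)$ is the largest $r$ such that there are linear maps $L_i:\mathbb{F}^{n}\to\mathbb{F}^r$ with $(L_1\otimes L_2\otimes L_3)T=\sum_{i=1}^r e_i\otimes e_i\otimes e_i$; $\boxtimes$ denotes the Kronecker product, and $\lim_{m\to\infty} Q(T^{\boxtimes m})^{1/m}$ is the asymptotic subrank. *)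

theory Defs
  imports
    Complex_Main
    "HOL-Combinatorics.Permutations"
    "Jordan_Normal_Form.DL_Rank"
begin

text \<open>
  A tensor in \<open>\<F>\<^sup>n \<otimes> \<F>\<^sup>n \<otimes> \<F>\<^sup>n\<close> is represented by its coordinates
  \<open>T i j k\<close> with \<open>i, j, k < n\<close>; the dimension \<open>n\<close> is passed separately and the values of
  \<open>T\<close> at all other indices are irrelevant.
\<close>

type_synonym 'a tensor3 = "nat \<Rightarrow> nat \<Rightarrow> nat \<Rightarrow> 'a"

definition symmetric_tensor :: "nat \<Rightarrow> 'a tensor3 \<Rightarrow> bool" where
  "symmetric_tensor n T \<longleftrightarrow>
    (\<forall>i \<sigma>. i \<in> {1..3::nat} \<rightarrow> {..<n} \<longrightarrow> \<sigma> permutes {1..3} \<longrightarrow>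
       T (i 1) (i 2) (i 3) = T (i (\<sigma> 1)) (i (\<sigma> 2)) (i (\<sigma> 3)))"

text \<open>
  The three flattenings as \<open>n \<times> n\<^sup>2\<close> matrices: the two grouped legs, with indices \<open>a\<close> and
  \<open>b\<close>, are encoded by the column \<open>a * n + b\<close>.
\<close>

definition flattening1 :: "nat \<Rightarrow> 'a tensor3 \<Rightarrow> 'a mat" where
  "flattening1 n T = mat n (n * n) (\<lambda>(i, c). T i (c div n) (c mod n))"

definition flattening2 :: "nat \<Rightarrow> 'a tensor3 \<Rightarrow> 'a mat" where
  "flattening2 n T = mat n (n * n) (\<lambda>(j, c). T (c div n) j (c mod n))"

definition flattening3 :: "nat \<Rightarrow> 'a tensor3 \<Rightarrow> 'a mat" where
  "flattening3 n T = mat n (n * n) (\<lambda>(k, c). T (c div n) (c mod n) k)"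

text \<open>The first argument of \<^const>\<open>vec_space.rank\<close> is the number of rows.\<close>

definition concise :: "nat \<Rightarrow> 'a::field tensor3 \<Rightarrow> bool" where
  "concise n T \<longleftrightarrow>
    vec_space.rank n (flattening1 n T) = n \<and>
    vec_space.rank n (flattening2 n T) = n \<and>
    vec_space.rank n (flattening3 n T) = n"

definition apply_tensor :: "nat \<Rightarrow> 'a::field mat \<Rightarrow> 'a mat \<Rightarrow> 'a mat \<Rightarrow> 'a tensor3 \<Rightarrow> 'a tensor3" where
  "apply_tensor n L1 L2 L3 T = (\<lambda>a b c.
     \<Sum>i<n. \<Sum>j<n. \<Sum>k<n. L1 $$ (a, i) * L2 $$ (b, j) * L3 $$ (c, k) * T i j k)"

definition unit_tensor :: "'a::field tensor3" where
  "unit_tensor = (\<lambda>a b c. if a = b \<and> b = c then 1 else 0)"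

definition restricts_to_unit :: "nat \<Rightarrow> 'a::field tensor3 \<Rightarrow> nat \<Rightarrow> bool" where
  "restricts_to_unit n T r \<longleftrightarrow>
    (\<exists>L1 \<in> carrier_mat r n. \<exists>L2 \<in> carrier_mat r n. \<exists>L3 \<in> carrier_mat r n.
       \<forall>a<r. \<forall>b<r. \<forall>c<r. apply_tensor n L1 L2 L3 T a b c = unit_tensor a b c)"

definition subrank :: "nat \<Rightarrow> 'a::field tensor3 \<Rightarrow> nat" where
  "subrank n T = (GREATEST r. restricts_to_unit n T r)"

text \<open>
  Kronecker product with a tensor \<open>S\<close> of dimension \<open>q\<close>; the pair of indices \<open>(i, i')\<close>
  with \<open>i' < q\<close> is encoded as \<open>i * q + i'\<close>.
\<close>

definition kronecker :: "nat \<Rightarrow> 'a::field tensor3 \<Rightarrow> 'a tensor3 \<Rightarrow> 'a tensor3" where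
  "kronecker q T S = (\<lambda>i j k.
     T (i div q) (j div q) (k div q) * S (i mod q) (j mod q) (k mod q))"

text \<open>The \<open>m\<close>-th Kronecker power of a tensor of dimension \<open>n\<close> has dimension \<open>n ^ m\<close>.\<close>

fun kronecker_power :: "nat \<Rightarrow> 'a::field tensor3 \<Rightarrow> nat \<Rightarrow> 'a tensor3" where
  "kronecker_power n T 0 = unit_tensor"
| "kronecker_power n T (Suc m) = kronecker n (kronecker_power n T m) T"

definition subrank_root_seq :: "nat \<Rightarrow> 'a::field tensor3 \<Rightarrow> nat \<Rightarrow> real" where
  "subrank_root_seq n T m = root m (real (subrank (n ^ m) (kronecker_power n T m)))"

definition asymptotic_subrank :: "nat \<Rightarrow> 'a::field tensor3 \<Rightarrow> real" where
  "asymptotic_subrank n T = lim (subrank_root_seq n T)"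

text \<open>The maximum defining the subrank exists.\<close>

lemma restricts_to_unit_0: "restricts_to_unit n T 0"
  unfolding restricts_to_unit_def by (auto intro!: bexI[of _ "0\<^sub>m 0 n"])

lemma restricts_to_unit_le:
  fixes T :: "'a::field tensor3"
  assumes "restricts_to_unit n T r"
  shows "r \<le> n"
proof (rule ccontr)
  assume "\<not> r \<le> n"
  then have nr: "n < r" by simp
  obtain L1 L2 L3 where
    L: "\<And>a b c. a < r \<Longrightarrow> b < r \<Longrightarrow> c < r \<Longrightarrow> apply_tensor n L1 L2 L3 T a b c = unit_tensor a b c"
    using assms unfolding restricts_to_unit_def by metis
  define M where "M = mat r r (\<lambda>(i, a). if i < n then L1 $$ (a, i) else 0)"
  have M: "M \<in> carrier_mat r r" by (simp add: M_def)
  have "det M = 0"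
  proof -
    have "M $$ (n, j) = 0" if "j < r" for j
      using that nr by (simp add: M_def)
    then show ?thesis
      using laplace_expansion_row[OF M nr] by simp
  qed
  then obtain v where v: "v \<in> carrier_vec r" "v \<noteq> 0\<^sub>v r" "M *\<^sub>v v = 0\<^sub>v r"
    using det_0_iff_vec_prod_zero[OF M] by blast
  have z: "(\<Sum>a<r. v $ a * L1 $$ (a, i)) = 0" if "i < n" for i
  proof -
    have "(M *\<^sub>v v) $ i = (\<Sum>a<r. L1 $$ (a, i) * v $ a)"
      using that nr v(1) by (simp add: M_def scalar_prod_def lessThan_atLeast0)
    then show ?thesis using v(3) that nr by (simp add: mult.commute)
  qed
  have "v $ b = 0" if b: "b < r" for b
  proof -
    have "v $ b = (\<Sum>a<r. v $ a * unit_tensor a b b)"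
      using b by (simp add: unit_tensor_def if_distrib sum.delta cong: if_cong)
    also have "\<dots> = (\<Sum>a<r. v $ a * apply_tensor n L1 L2 L3 T a b b)"
      using L b by simp
    also have "\<dots> = (\<Sum>a<r. \<Sum>i<n. \<Sum>j<n. \<Sum>k<n.
        (v $ a * L1 $$ (a, i)) * (L2 $$ (b, j) * L3 $$ (b, k) * T i j k))"
      by (simp add: apply_tensor_def sum_distrib_left mult.assoc)
    also have "\<dots> = (\<Sum>i<n. \<Sum>a<r. (v $ a * L1 $$ (a, i)) *
        (\<Sum>j<n. \<Sum>k<n. L2 $$ (b, j) * L3 $$ (b, k) * T i j k))"
      by (subst sum.swap) (simp add: sum_distrib_left)
    also have "\<dots> = 0"
      by (simp add: sum_distrib_right[symmetric] z)
    finally show ?thesis .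
  qed
  then show False using v(1,2) by auto
qed

lemma restricts_to_unit_subrank: "restricts_to_unit n T (subrank n T)"
  unfolding subrank_def
  by (rule GreatestI_nat[where P = "restricts_to_unit n T" and k = 0 and b = n])
    (auto intro: restricts_to_unit_0 restricts_to_unit_le)

lemma le_subrank: "restricts_to_unit n T r \<Longrightarrow> r \<le> subrank n T"
  unfolding subrank_def by (rule Greatest_le_nat[where b = n]) (auto intro: restricts_to_unit_le)

end

theory Submission
  imports Defs "HOL-Library.Multiset"
begin

text \<open>
  Let \<open>N = n ^ m\<close>. Bringing the slices of the \<open>m\<close>-th Kronecker power of \<open>T\<close> into echelon form for
  the lexicographic order on positions \<open>(i, j)\<close>, one sees that it degenerates to
  \<open>\<Sum>s<N. e s \<otimes> e (p s) \<otimes> e (q s)\<close>, where the pairs \<open>(p s, q s)\<close> are the distinct edges of a bipartite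
  graph. If the graph has a matching of size at least \<open>\<surd>N\<close>, the restriction to this matching is
  diagonal. Otherwise the endpoints of a maximal matching cover all edges, so at least half of the
  edges touch one side of the cover; these edges \<open>E\<close> have fewer than \<open>\<surd>N\<close> endpoints on that side
  and at most \<open>N\<close> on the other. By symmetry of \<open>T\<close>, the third power degenerates to the product of
  the three cyclic rotations of this graph tensor, whose support is \<open>E \<times> E \<times> E\<close>. Fixing the sums of
  the labels of the left and of the right endpoints of a triple of edges turns the support into a
  diagonal, and this is again a degeneration since a sum of squares of linear forms in the labels
  splits into functions of the single legs. By pigeonhole, some choice of the sums leaves at least
  \<open>N powr (3/2) / 72\<close> triples. Degenerations cost only a polynomial factor in high Kronecker powers,
  so the asymptotic subrank is at least \<open>\<surd>n\<close> up to a factor that tends to \<open>1\<close> as \<open>m\<close> grows.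
\<close>

section \<open>Restriction of tensors\<close>

text \<open>Index sets are arbitrary and the linear maps are plain functions, so that pairs and
  lists can serve as indices without being coded as numbers.\<close>

definition restriction :: "'i set \<Rightarrow> ('i \<Rightarrow> 'i \<Rightarrow> 'i \<Rightarrow> 'a::field) \<Rightarrow> 'j set \<Rightarrow> ('j \<Rightarrow> 'j \<Rightarrow> 'j \<Rightarrow> 'a) \<Rightarrow> bool" where
  "restriction I S J R \<longleftrightarrow>
    (\<exists>L1 L2 L3. \<forall>a\<in>J. \<forall>b\<in>J. \<forall>c\<in>J.
       R a b c = (\<Sum>(i, j, k)\<in>I \<times> I \<times> I. L1 a i * L2 b j * L3 c k * S i j k))"

definition tensor_prod ::
  "('i \<Rightarrow> 'i \<Rightarrow> 'i \<Rightarrow> 'a::field) \<Rightarrow> ('j \<Rightarrow> 'j \<Rightarrow> 'j \<Rightarrow> 'a) \<Rightarrow> 'i \<times> 'j \<Rightarrow> 'i \<times> 'j \<Rightarrow> 'i \<times> 'j \<Rightarrow> 'a" where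
  "tensor_prod S R = (\<lambda>(x, x') (y, y') (z, z'). S x y z * R x' y' z')"

lemma sum_prod3:
  fixes f :: "'x \<Rightarrow> 'a::comm_semiring_0"
  shows "sum f A * sum g B * sum h C = (\<Sum>(a, b, c)\<in>A \<times> B \<times> C. f a * g b * h c)"
proof -
  have "sum g B * sum h C = (\<Sum>(b, c)\<in>B \<times> C. g b * h c)"
    by (simp add: sum_product sum.cartesian_product)
  then have "sum f A * sum g B * sum h C = sum f A * (\<Sum>(b, c)\<in>B \<times> C. g b * h c)"
    by (simp add: mult.assoc)
  also have "\<dots> = (\<Sum>(a, b, c)\<in>A \<times> B \<times> C. f a * g b * h c)"
    by (simp add: sum_product sum.cartesian_product case_prod_beta mult.assoc)
  finally show ?thesis .
qed

text \<open>The maps compose leg by leg: once the sums are exchanged, the inner sum factors by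
  \<open>sum_prod3\<close> into three matrix products.\<close>

lemma restriction_trans:
  assumes "restriction I S J R" and "restriction J R K Q"
  shows "restriction I S K Q"
proof -
  obtain L1 L2 L3 where L: "\<And>a b c. a \<in> J \<Longrightarrow> b \<in> J \<Longrightarrow> c \<in> J \<Longrightarrow>
      R a b c = (\<Sum>(i, j, k)\<in>I \<times> I \<times> I. L1 a i * L2 b j * L3 c k * S i j k)"
    using assms(1) unfolding restriction_def Ball_def by blast
  obtain M1 M2 M3 where M: "\<And>a b c. a \<in> K \<Longrightarrow> b \<in> K \<Longrightarrow> c \<in> K \<Longrightarrow>
      Q a b c = (\<Sum>(i, j, k)\<in>J \<times> J \<times> J. M1 a i * M2 b j * M3 c k * R i j k)"
    using assms(2) unfolding restriction_def Ball_def by blast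
  show ?thesis
    unfolding restriction_def
  proof (intro exI ballI)
    fix a b c assume abc: "a \<in> K" "b \<in> K" "c \<in> K"
    have "Q a b c = (\<Sum>(x, y, z)\<in>J \<times> J \<times> J. \<Sum>(i, j, k)\<in>I \<times> I \<times> I.
        (M1 a x * L1 x i) * (M2 b y * L2 y j) * (M3 c z * L3 z k) * S i j k)"
      unfolding M[OF abc]
      by (rule sum.cong) (auto simp: L sum_distrib_left ac_simps intro!: sum.cong)
    also have "\<dots> = (\<Sum>(i, j, k)\<in>I \<times> I \<times> I. (\<Sum>(x, y, z)\<in>J \<times> J \<times> J.
        (M1 a x * L1 x i) * (M2 b y * L2 y j) * (M3 c z * L3 z k)) * S i j k)"
      unfolding case_prod_beta by (subst sum.swap) (simp add: sum_distrib_right)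
    also have "\<dots> = (\<Sum>(i, j, k)\<in>I \<times> I \<times> I.
        (\<Sum>x\<in>J. M1 a x * L1 x i) * (\<Sum>y\<in>J. M2 b y * L2 y j) * (\<Sum>z\<in>J. M3 c z * L3 z k) * S i j k)"
      unfolding sum_prod3 ..
    finally show "Q a b c = (\<Sum>(i, j, k)\<in>I \<times> I \<times> I.
        (\<lambda>a i. \<Sum>x\<in>J. M1 a x * L1 x i) a i * (\<lambda>b j. \<Sum>y\<in>J. M2 b y * L2 y j) b j
          * (\<lambda>c k. \<Sum>z\<in>J. M3 c z * L3 z k) c k * S i j k)"
      by simp
  qed
qed

lemma restriction_tensor_prod:
  assumes "restriction I S J R" and "restriction I' S' J' R'"
  shows "restriction (I \<times> I') (tensor_prod S S') (J \<times> J') (tensor_prod R R')"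
proof -
  obtain L1 L2 L3 where L: "\<And>a b c. a \<in> J \<Longrightarrow> b \<in> J \<Longrightarrow> c \<in> J \<Longrightarrow>
      R a b c = (\<Sum>(i, j, k)\<in>I \<times> I \<times> I. L1 a i * L2 b j * L3 c k * S i j k)"
    using assms(1) unfolding restriction_def Ball_def by blast
  obtain M1 M2 M3 where M: "\<And>a b c. a \<in> J' \<Longrightarrow> b \<in> J' \<Longrightarrow> c \<in> J' \<Longrightarrow>
      R' a b c = (\<Sum>(i, j, k)\<in>I' \<times> I' \<times> I'. M1 a i * M2 b j * M3 c k * S' i j k)"
    using assms(2) unfolding restriction_def Ball_def by blast
  let ?N = "\<lambda>L M (a, a') (i, i'). L a i * M a' i'"
  let ?h = "\<lambda>((i, j, k), (i', j', k')). ((i, i'), (j, j'), (k, k'))"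
  have "tensor_prod R R' p q r = (\<Sum>(x, y, z)\<in>(I \<times> I') \<times> (I \<times> I') \<times> (I \<times> I').
      ?N L1 M1 p x * ?N L2 M2 q y * ?N L3 M3 r z * tensor_prod S S' x y z)"
    if "p \<in> J \<times> J'" "q \<in> J \<times> J'" "r \<in> J \<times> J'" for p q r
  proof -
    obtain a a' b b' c c' where e: "p = (a, a')" "q = (b, b')" "r = (c, c')"
      by (metis surj_pair)
    have "tensor_prod R R' p q r = (\<Sum>s\<in>(I \<times> I \<times> I) \<times> (I' \<times> I' \<times> I'). 
        case s of ((i, j, k), (i', j', k')) \<Rightarrow>
        (L1 a i * L2 b j * L3 c k * S i j k) * (M1 a' i' * M2 b' j' * M3 c' k' * S' i' j' k'))"
      using that unfolding e tensor_prod_def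
      by (simp add: L M sum_product sum.cartesian_product case_prod_beta)
    also have "\<dots> = (\<Sum>(x, y, z)\<in>(I \<times> I') \<times> (I \<times> I') \<times> (I \<times> I').
      ?N L1 M1 p x * ?N L2 M2 q y * ?N L3 M3 r z * tensor_prod S S' x y z)"
      by (rule sum.reindex_bij_witness[where j = ?h
            and i = "\<lambda>((i, i'), (j, j'), (k, k')). ((i, j, k), (i', j', k'))"])
        (auto simp: tensor_prod_def e ac_simps)
    finally show ?thesis .
  qed
  then show ?thesis
    unfolding restriction_def by blast
qed

text \<open>Each map has at most one nonzero entry per row, so the sum collapses to one term. The
  legs are selected separately; the factor \<open>\<alpha>\<close> serves to scale a diagonal to
  \<open>unit_tensor\<close>.\<close>

lemma restriction_select:
  assumes "finite I" and "f ` J \<subseteq> I" and "g ` J \<subseteq> I" and "h ` J \<subseteq> I"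
    and "\<And>a b c. a \<in> J \<Longrightarrow> b \<in> J \<Longrightarrow> c \<in> J \<Longrightarrow> R a b c = \<alpha> a * S (f a) (g b) (h c)"
  shows "restriction I S J R"
  unfolding restriction_def
proof (intro exI ballI)
  fix a b c assume abc: "a \<in> J" "b \<in> J" "c \<in> J"
  let ?L1 = "\<lambda>a i. if i = f a then \<alpha> a else 0"
  let ?L2 = "\<lambda>b i. if i = g b then 1 else 0"
  let ?L3 = "\<lambda>c i. if i = h c then 1 else 0"
  have "(\<Sum>(i, j, k)\<in>I \<times> I \<times> I. ?L1 a i * ?L2 b j * ?L3 c k * S i j k) =
    (\<Sum>(i, j, k)\<in>{(f a, g b, h c)}. ?L1 a i * ?L2 b j * ?L3 c k * S i j k)"
    using assms(1-4) abc by (intro sum.mono_neutral_right) (auto split: if_splits)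
  then show "R a b c = (\<Sum>(i, j, k)\<in>I \<times> I \<times> I. ?L1 a i * ?L2 b j * ?L3 c k * S i j k)"
    using assms(5)[OF abc] by simp
qed

text \<open>With identities on the other two legs, forming linear combinations of slices is a
  restriction.\<close>

lemma restriction_leg1:
  assumes "finite I"
    and "\<And>a b c. a \<in> I \<Longrightarrow> b \<in> I \<Longrightarrow> c \<in> I \<Longrightarrow> R a b c = (\<Sum>l\<in>I. G a l * S l b c)"
  shows "restriction I S I R"
  unfolding restriction_def
proof (intro exI ballI)
  fix a b c assume abc: "a \<in> I" "b \<in> I" "c \<in> I"
  let ?L = "\<lambda>b i. if i = b then 1 else 0"
  have "(\<Sum>(i, j, k)\<in>I \<times> I \<times> I. G a i * ?L b j * ?L c k * S i j k) =
     (\<Sum>(i, j, k)\<in>I \<times> {b} \<times> {c}. G a i * ?L b j * ?L c k * S i j k)"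
    using assms(1) abc by (intro sum.mono_neutral_right) (auto split: if_splits)
  also have "\<dots> = (\<Sum>l\<in>I. G a l * S l b c)"
    by (simp add: sum.cartesian_product[symmetric])
  finally show "R a b c = (\<Sum>(i, j, k)\<in>I \<times> I \<times> I. G a i * ?L b j * ?L c k * S i j k)"
    using assms(2)[OF abc] by simp
qed

lemma restriction_rotate:
  assumes "restriction I S J R"
  shows "restriction I (\<lambda>x y z. S y z x) J (\<lambda>x y z. R y z x)"
proof -
  obtain L1 L2 L3 where L: "\<And>a b c. a \<in> J \<Longrightarrow> b \<in> J \<Longrightarrow> c \<in> J \<Longrightarrow>
      R a b c = (\<Sum>(i, j, k)\<in>I \<times> I \<times> I. L1 a i * L2 b j * L3 c k * S i j k)"
    using assms unfolding restriction_def Ball_def by blast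
  show ?thesis
    unfolding restriction_def
  proof (intro exI ballI)
    fix a b c assume abc: "a \<in> J" "b \<in> J" "c \<in> J"
    show "R b c a = (\<Sum>(i, j, k)\<in>I \<times> I \<times> I. L3 a i * L1 b j * L2 c k * S j k i)"
      unfolding L[OF abc(2,3,1)]
      by (rule sum.reindex_bij_witness[where j = "\<lambda>(i, j, k). (k, i, j)"
            and i = "\<lambda>(k, i, j). (i, j, k)"]) (auto simp: ac_simps)
  qed
qed

lemma restriction_cong:
  assumes "\<And>i j k. i \<in> I \<Longrightarrow> j \<in> I \<Longrightarrow> k \<in> I \<Longrightarrow> S i j k = S' i j k"
    and "\<And>i j k. i \<in> J \<Longrightarrow> j \<in> J \<Longrightarrow> k \<in> J \<Longrightarrow> R i j k = R' i j k"
  shows "restriction I S J R \<longleftrightarrow> restriction I S' J R'"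
proof -
  have "(\<Sum>(i, j, k)\<in>I \<times> I \<times> I. f i j k * S i j k) = (\<Sum>(i, j, k)\<in>I \<times> I \<times> I. f i j k * S' i j k)"
    for f
    using assms(1) by (intro sum.cong) auto
  then show ?thesis
    using assms(2) unfolding restriction_def by simp
qed

section \<open>The subrank in terms of restrictions\<close>

lemma restricts_to_unit_iff_restriction:
  "restricts_to_unit n T r \<longleftrightarrow> restriction {..<n} T {..<r} unit_tensor"
proof
  assume "restricts_to_unit n T r"
  then obtain L1 L2 L3 where
    "\<And>a b c. a < r \<Longrightarrow> b < r \<Longrightarrow> c < r \<Longrightarrow> apply_tensor n L1 L2 L3 T a b c = unit_tensor a b c"
    unfolding restricts_to_unit_def by metis
  then have "\<forall>a\<in>{..<r}. \<forall>b\<in>{..<r}. \<forall>c\<in>{..<r}. unit_tensor a b c =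
      (\<Sum>(i, j, k)\<in>{..<n} \<times> {..<n} \<times> {..<n}.
        curry (($$) L1) a i * curry (($$) L2) b j * curry (($$) L3) c k * T i j k)"
    by (simp add: apply_tensor_def sum.cartesian_product[symmetric])
  then show "restriction {..<n} T {..<r} unit_tensor"
    unfolding restriction_def by blast
next
  assume "restriction {..<n} T {..<r} unit_tensor"
  then obtain L1 L2 L3 where
    L: "\<And>a b c. a < r \<Longrightarrow> b < r \<Longrightarrow> c < r \<Longrightarrow> unit_tensor a b c =
      (\<Sum>(i, j, k)\<in>{..<n} \<times> {..<n} \<times> {..<n}. L1 a i * L2 b j * L3 c k * T i j k)"
    unfolding restriction_def Ball_def lessThan_iff by blast
  have "apply_tensor n (mat r n (case_prod L1)) (mat r n (case_prod L2)) (mat r n (case_prod L3)) T a b c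
      = unit_tensor a b c" if "a < r" "b < r" "c < r" for a b c
    unfolding L[OF that] using that
    by (simp add: apply_tensor_def sum.cartesian_product[symmetric])
  then show "restricts_to_unit n T r"
    unfolding restricts_to_unit_def by (blast intro: mat_carrier)
qed

lemma restriction_subrank: "restriction {..<n} T {..<r} unit_tensor \<Longrightarrow> r \<le> subrank n T"
  using le_subrank restricts_to_unit_iff_restriction by blast

section \<open>Kronecker powers: splitting, supermultiplicativity of the subrank, symmetry\<close>

lemma index_pair_less:
  fixes i i' p q :: nat
  assumes "i < p" and "i' < q"
  shows "i * q + i' < p * q"
proof -
  have "i * q + i' < Suc i * q" using assms(2) by simp
  also have "\<dots> \<le> p * q" using assms(1) by (intro mult_le_mono1) simp
  finally show ?thesis .
qed

text \<open>In base \<open>n\<close>, the last \<open>b\<close> digits of an index belong to the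
  second factor. The induction strips one digit at a time: \<open>div n\<close> drops the last digit
  of \<open>i'\<close> and leaves those of \<open>i\<close> alone.\<close>

lemma kronecker_power_add:
  fixes n :: nat
  assumes "i' < n ^ b" and "j' < n ^ b" and "k' < n ^ b"
  shows "kronecker_power n T (a + b) (i * n ^ b + i') (j * n ^ b + j') (k * n ^ b + k')
    = kronecker_power n T a i j k * kronecker_power n T b i' j' k'"
  using assms
proof (induction b arbitrary: i' j' k')
  case 0
  then show ?case by (simp add: unit_tensor_def)
next
  case (Suc b)
  then have n: "n > 0" by (cases n) auto
  have dm: "(i * (n ^ b * n) + i') div n = i * n ^ b + i' div n"
    "(i * (n ^ b * n) + i') mod n = i' mod n" for i i'
  proof -
    have *: "i * (n ^ b * n) + i' = i' + n * (i * n ^ b)" by simp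
    show "(i * (n ^ b * n) + i') div n = i * n ^ b + i' div n"
      using n unfolding * by (subst div_mult_self2) auto
    show "(i * (n ^ b * n) + i') mod n = i' mod n"
      unfolding * by (rule mod_mult_self2)
  qed
  have "x div n < n ^ b" if "x < n ^ b * n" for x
    using that by (rule less_mult_imp_div_less)
  then show ?case
    using Suc by (simp add: kronecker_def dm mult.commute[of n])
qed

lemma restriction_kronecker_power_add:
  "restriction {..<n ^ (a + b)} (kronecker_power n T (a + b)) ({..<n ^ a} \<times> {..<n ^ b})
     (tensor_prod (kronecker_power n T a) (kronecker_power n T b))"
proof -
  let ?f = "\<lambda>(i, i'). i * n ^ b + i'"
  have "?f ` ({..<n ^ a} \<times> {..<n ^ b}) \<subseteq> {..<n ^ (a + b)}"
    by (auto simp: power_add intro: index_pair_less)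
  then show ?thesis
    by (intro restriction_select[where f = ?f and g = ?f and h = ?f and \<alpha> = "\<lambda>_. 1"])
      (auto simp: tensor_prod_def kronecker_power_add)
qed

lemma restriction_unit_tensor_prod:
  "restriction ({..<r} \<times> {..<s}) (tensor_prod unit_tensor unit_tensor)
     {..<r * s} (unit_tensor :: 'a::field tensor3)"
proof -
  let ?f = "\<lambda>a. (a div s, a mod s)"
  have eq: "a = b" if "a div s = b div s" "a mod s = b mod s" for a b
    using that by (metis div_mult_mod_eq)
  have "s > 0" if "a < r * s" for a
    using that by (cases s) auto
  then have "?f ` {..<r * s} \<subseteq> {..<r} \<times> {..<s}"
    by (auto intro: less_mult_imp_div_less)
  then show ?thesis
    by (intro restriction_select[where f = ?f and g = ?f and h = ?f and \<alpha> = "\<lambda>_. 1"])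
      (auto simp: tensor_prod_def unit_tensor_def intro: eq)
qed

text \<open>A product of unit tensors is a unit tensor. This supermultiplicativity is the input of
  Fekete's lemma.\<close>

lemma subrank_kronecker_power_add:
  "subrank (n ^ a) (kronecker_power n T a) * subrank (n ^ b) (kronecker_power n T b)
    \<le> subrank (n ^ (a + b)) (kronecker_power n T (a + b))"
proof -
  have unit: "restriction {..<n ^ m} (kronecker_power n T m)
      {..<subrank (n ^ m) (kronecker_power n T m)} unit_tensor" for m
    using restricts_to_unit_subrank restricts_to_unit_iff_restriction by blast
  show ?thesis
    using restriction_trans[OF restriction_kronecker_power_add
        restriction_trans[OF restriction_tensor_prod[OF unit unit] restriction_unit_tensor_prod]]
    by (rule restriction_subrank)
qed

lemma symmetric_tensor_swap:
  assumes "symmetric_tensor n T" and "i < n" and "j < n" and "k < n"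
  shows "T i j k = T j i k" and "T i j k = T i k j"
proof -
  let ?x = "\<lambda>m::nat. if m = 1 then i else if m = 2 then j else k"
  have x: "?x \<in> {1..3} \<rightarrow> {..<n}"
    using assms(2-4) by auto
  have "transpose 1 2 permutes {1..3::nat}" "transpose 2 3 permutes {1..3::nat}"
    by (auto intro!: permutes_swap_id)
  from this[THEN assms(1)[unfolded symmetric_tensor_def, rule_format, OF x]]
  show "T i j k = T j i k" and "T i j k = T i k j"
    by (simp_all add: transpose_def)
qed

lemma kronecker_power_swap:
  assumes "symmetric_tensor n T" and "i < n ^ m" and "j < n ^ m" and "k < n ^ m"
  shows "kronecker_power n T m i j k = kronecker_power n T m j i k"
    and "kronecker_power n T m i j k = kronecker_power n T m i k j"
proof -
  have "kronecker_power n T m i j k = kronecker_power n T m j i k \<and>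
    kronecker_power n T m i j k = kronecker_power n T m i k j"
    using assms(2-4)
  proof (induction m arbitrary: i j k)
    case 0
    then show ?case by auto
  next
    case (Suc m)
    have dm: "x div n < n ^ m" "x mod n < n" if "x < n * n ^ m" for x
      using that by (cases n; auto intro: less_mult_imp_div_less simp: mult.commute)+
    show ?case
      using Suc symmetric_tensor_swap[OF assms(1)] by (simp add: kronecker_def dm)
  qed
  then show "kronecker_power n T m i j k = kronecker_power n T m j i k"
    and "kronecker_power n T m i j k = kronecker_power n T m i k j"
    by blast+
qed

section \<open>Echelon form of the slices\<close>

text \<open>Linear independence of the rows of the first flattening, phrased so that it can be
  carried through Kronecker powers by induction.\<close>

definition slices_independent :: "nat \<Rightarrow> 'a::field tensor3 \<Rightarrow> bool" where
  "slices_independent n T \<longleftrightarrow>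
    (\<forall>v. (\<forall>j<n. \<forall>k<n. (\<Sum>l<n. v l * T l j k) = 0) \<longrightarrow> (\<forall>l<n. v l = 0))"

text \<open>Split an index as \<open>x * n + x'\<close>. For fixed \<open>j'\<close> and
  \<open>k'\<close> the sums over \<open>x'\<close> are the coefficients of a vanishing combination
  of slices of the smaller power, so they are zero; independence for \<open>T\<close> then kills
  each \<open>v (x * n + x')\<close>.\<close>

lemma slices_independent_kronecker_power:
  assumes "slices_independent n T"
  shows "slices_independent (n ^ m) (kronecker_power n T m)"
proof (induction m)
  case 0
  then show ?case by (simp add: slices_independent_def unit_tensor_def)
next
  case (Suc m)
  let ?K = "kronecker_power n T m"
  show ?case
    unfolding slices_independent_def
  proof (intro allI impI)
    fix v l
    assume v: "\<forall>j<n ^ Suc m. \<forall>k<n ^ Suc m. (\<Sum>l<n ^ Suc m. v l * kronecker_power n T (Suc m) l j k) = 0"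
      and l: "l < n ^ Suc m"
    have n: "n > 0" using l by (cases n) auto
    have z: "(\<Sum>x'<n. v (x * n + x') * T x' j' k') = 0"
      if "j' < n" "k' < n" "x < n ^ m" for j' k' x
    proof -
      have "(\<Sum>x<n ^ m. (\<Sum>x'<n. v (x * n + x') * T x' j' k') * ?K x j k) = 0"
        if "j < n ^ m" "k < n ^ m" for j k
      proof -
        have "(\<Sum>x<n ^ m. (\<Sum>x'<n. v (x * n + x') * T x' j' k') * ?K x j k)
          = (\<Sum>(x, x')\<in>{..<n ^ m} \<times> {..<n}. v (x * n + x') * (?K x j k * T x' j' k'))"
          by (simp add: sum_distrib_left sum_distrib_right sum.cartesian_product[symmetric] ac_simps)
        also have "\<dots> = (\<Sum>l<n ^ Suc m. v l * kronecker_power n T (Suc m) l (j * n + j') (k * n + k'))"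
          by (rule sum.reindex_bij_witness[where i = "\<lambda>l. (l div n, l mod n)"
                and j = "\<lambda>(x, x'). x * n + x'"])
            (use n \<open>j' < n\<close> \<open>k' < n\<close> in \<open>auto simp: kronecker_def mult.commute[of n]
               intro: index_pair_less less_mult_imp_div_less\<close>)
        also have "\<dots> = 0"
          using v[rule_format, of "j * n + j'" "k * n + k'"] that \<open>j' < n\<close> \<open>k' < n\<close>
          by (simp add: mult.commute[of n] index_pair_less del: kronecker_power.simps)
        finally show ?thesis .
      qed
      then show ?thesis
        using Suc[unfolded slices_independent_def, rule_format,
            of "\<lambda>x. \<Sum>x'<n. v (x * n + x') * T x' j' k'"] \<open>x < n ^ m\<close> by blast
    qed
    have "v (x * n + x') = 0" if "x < n ^ m" "x' < n" for x x'
      using assms[unfolded slices_independent_def, rule_format, of "\<lambda>x'. v (x * n + x')" x'] z that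
      by blast
    from this[of "l div n" "l mod n"] show "v l = 0"
      using l n by (simp add: less_mult_imp_div_less mult.commute[of n])
  qed
qed

text \<open>This passes from column rank to row independence: \<open>n\<close> independent columns
  form an invertible matrix \<open>B\<close>, and the coefficients of a vanishing combination of
  slices lie in the kernel of \<open>transpose_mat B\<close>.\<close>

lemma concise_slices_independent:
  assumes "concise n T"
  shows "slices_independent n T"
  unfolding slices_independent_def
proof (intro allI impI)
  fix v l assume v: "\<forall>j<n. \<forall>k<n. (\<Sum>l<n. v l * T l j k) = 0" and l: "l < n"
  interpret vec_space "TYPE('a)" n .
  let ?A = "flattening1 n T"
  have A: "?A \<in> carrier_mat n (n * n)" by (simp add: flattening1_def)
  obtain U where U: "maximal U (\<lambda>W. W \<subseteq> set (cols ?A) \<and> lin_indpt W)"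
    using maximal_exists_superset[of "set (cols ?A)" "\<lambda>W. W \<subseteq> set (cols ?A) \<and> lin_indpt W" "{}"]
    by (auto simp: lin_dep_def)
  have Usub: "U \<subseteq> set (cols ?A)" and Uli: "lin_indpt U" using U unfolding maximal_def by auto
  have cU: "card U = n"
    using rank_card_indpt[OF A U] assms by (simp add: concise_def)
  obtain us where us: "set us = U" "distinct us"
    using finite_distinct_list[of U] Usub finite_subset by blast
  have len: "length us = n" using cU us distinct_card by fastforce
  have Uc: "set us \<subseteq> carrier_vec n"
    using Usub cols_dim[of ?A] A us by auto
  define B where "B = mat_of_cols n us"
  have B: "B \<in> carrier_mat n n" by (simp add: B_def len[symmetric])
  have cB: "cols B = us" using Uc by (simp add: B_def cols_mat_of_cols)
  have "rank B = n" using lin_indpt_full_rank[OF B] cB us Uli by simp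
  then have "det B \<noteq> 0" using det_rank_iff[OF B] by simp
  then have dT: "det (transpose_mat B) \<noteq> 0" using det_transpose[OF B] by simp
  have orth: "u \<bullet> vec n v = 0" if "u \<in> U" for u
  proof -
    have "u \<in> col ?A ` {0..<n * n}"
      using that Usub A by (auto simp: cols_def)
    then obtain c where c: "c < n * n" "u = col ?A c"
      by auto
    have "n > 0" using l by simp
    then have "c div n < n" "c mod n < n" using c by (auto intro: less_mult_imp_div_less)
    then show ?thesis
      using v c A by (simp add: flattening1_def scalar_prod_def lessThan_atLeast0 mult.commute)
  qed
  have "transpose_mat B *\<^sub>v vec n v = 0\<^sub>v n"
  proof (rule eq_vecI)
    fix i assume i: "i < dim_vec (0\<^sub>v n :: 'a vec)"
    then have "row (transpose_mat B) i = us ! i"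
      using B cB len by (metis cols_nth carrier_matD(2) index_zero_vec(2) row_transpose)
    then show "(transpose_mat B *\<^sub>v vec n v) $ i = 0\<^sub>v n $ i"
      using i B orth us len by auto
  qed (use B in simp)
  then have "vec n v = 0\<^sub>v n"
    using det_0_iff_vec_prod_zero[of "transpose_mat B" n] B dT vec_carrier[of n v]
    by (metis transpose_carrier_mat)
  then have "vec n v $ l = 0\<^sub>v n $ l" by simp
  then show "v l = 0" using l by simp
qed

lemma exists_kernel_vector:
  fixes A :: "nat \<Rightarrow> nat \<Rightarrow> 'a::field"
  assumes "r < n"
  obtains v where "\<exists>l<n. v l \<noteq> 0" and "\<And>i. i < r \<Longrightarrow> (\<Sum>l<n. A i l * v l) = 0"
proof -
  \<comment> \<open>Zero rows make the system square; row \<open>r\<close> is zero, so the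
    determinant vanishes.\<close>
  define M where "M = mat n n (\<lambda>(i, l). if i < r then A i l else 0)"
  have M: "M \<in> carrier_mat n n" by (simp add: M_def)
  have "M $$ (r, l) = 0" if "l < n" for l
    using that assms by (simp add: M_def)
  then have "det M = 0"
    using laplace_expansion_row[OF M assms] by simp
  then obtain v where v: "v \<in> carrier_vec n" "v \<noteq> 0\<^sub>v n" "M *\<^sub>v v = 0\<^sub>v n"
    using det_0_iff_vec_prod_zero[OF M] by blast
  have "\<exists>l<n. v $ l \<noteq> 0"
  proof (rule ccontr)
    assume "\<not> ?thesis"
    then have "v = 0\<^sub>v n" using v(1) by (intro eq_vecI) auto
    then show False using v(2) by simp
  qed
  moreover have "(\<Sum>l<n. A i l * v $ l) = 0" if "i < r" for i
  proof -
    have "(M *\<^sub>v v) $ i = (\<Sum>l<n. A i l * v $ l)"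
      using that assms v(1) by (simp add: M_def scalar_prod_def lessThan_atLeast0)
    then show ?thesis using v(3) that assms by simp
  qed
  ultimately show thesis using that by blast
qed

text \<open>Elimination is replaced by counting. Let \<open>P\<close> be the set of positions where
  some combination has its first nonzero value. If \<open>P\<close> had fewer than \<open>n\<close>
  elements, a nontrivial combination would vanish on \<open>P\<close>, although its own first
  nonzero position lies in \<open>P\<close>. Any injection into \<open>P\<close> then serves as
  \<open>pos\<close>.\<close>

lemma echelon_form:
  fixes f :: "nat \<Rightarrow> nat \<Rightarrow> 'a::field"
  assumes indep: "\<forall>v. (\<forall>x<m. (\<Sum>l<n. v l * f l x) = 0) \<longrightarrow> (\<forall>l<n. v l = 0)"
  obtains G :: "nat \<Rightarrow> nat \<Rightarrow> 'a" and pos where "inj_on pos {..<n}"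
    and "\<And>s. s < n \<Longrightarrow> pos s < m"
    and "\<And>s. s < n \<Longrightarrow> (\<Sum>l<n. G s l * f l (pos s)) \<noteq> 0"
    and "\<And>s x. s < n \<Longrightarrow> x < pos s \<Longrightarrow> (\<Sum>l<n. G s l * f l x) = 0"
proof -
  define P where "P = {x. x < m \<and>
    (\<exists>g. (\<Sum>l<n. g l * f l x) \<noteq> 0 \<and> (\<forall>y<x. (\<Sum>l<n. g l * f l y) = 0))}"
  have "finite P" unfolding P_def by simp
  have "n \<le> card P"
  proof (rule ccontr)
    assume "\<not> n \<le> card P"
    then have "card P < n" by simp
    obtain h where h: "bij_betw h {..<card P} P"
      using \<open>finite P\<close> by (metis ex_bij_betw_nat_finite lessThan_atLeast0)
    obtain v where v: "\<exists>l<n. v l \<noteq> 0" "\<And>i. i < card P \<Longrightarrow> (\<Sum>l<n. f l (h i) * v l) = 0"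
      using exists_kernel_vector[OF \<open>card P < n\<close>, where A = "\<lambda>i l. f l (h i)"] by metis
    have vP: "(\<Sum>l<n. v l * f l x) = 0" if "x \<in> P" for x
    proof -
      have "x \<in> h ` {..<card P}" using that h by (simp add: bij_betw_def)
      then show ?thesis using v(2) by (auto simp: mult.commute)
    qed
    let ?Q = "\<lambda>x. x < m \<and> (\<Sum>l<n. v l * f l x) \<noteq> 0"
    have ex: "\<exists>x. ?Q x" using indep v(1) by blast
    define x where "x = (LEAST x. ?Q x)"
    have "?Q x" unfolding x_def by (rule LeastI_ex[OF ex])
    moreover have "(\<Sum>l<n. v l * f l y) = 0" if "y < x" for y
      using not_less_Least[OF that[unfolded x_def]] that \<open>?Q x\<close> by simp
    ultimately have "x \<in> P" unfolding P_def by blast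
    then show False using vP \<open>?Q x\<close> by blast
  qed
  then obtain pos where pos: "pos ` {..<n} \<subseteq> P" "inj_on pos {..<n}"
    using card_le_inj[of "{..<n}" P] \<open>finite P\<close> by auto
  have "\<forall>s\<in>{..<n}. \<exists>g. (\<Sum>l<n. g l * f l (pos s)) \<noteq> 0 \<and> (\<forall>y<pos s. (\<Sum>l<n. g l * f l y) = 0)"
    using pos(1) unfolding P_def by blast
  then obtain G where "\<forall>s\<in>{..<n}. (\<Sum>l<n. G s l * f l (pos s)) \<noteq> 0 \<and>
      (\<forall>y<pos s. (\<Sum>l<n. G s l * f l y) = 0)"
    by metis
  moreover have "pos s < m" if "s < n" for s
    using pos(1) that unfolding P_def by blast
  ultimately show thesis using that[OF pos(2)] by blast
qed

text \<open>The positions are \<open>x = i * n + j\<close>, whose numerical order is the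
  lexicographic order of the pairs \<open>(i, j)\<close>.\<close>

lemma tensor_echelon_form:
  assumes "slices_independent n T"
  obtains G p q where "inj_on (\<lambda>s. (p s, q s)) {..<n}"
    and "\<And>s. s < n \<Longrightarrow> p s < n" and "\<And>s. s < n \<Longrightarrow> q s < n"
    and "\<And>s. s < n \<Longrightarrow> (\<Sum>l<n. G s l * T l (p s) (q s)) \<noteq> 0"
    and "\<And>s i j. s < n \<Longrightarrow> i < n \<Longrightarrow> j < n \<Longrightarrow> (\<Sum>l<n. G s l * T l i j) \<noteq> 0 \<Longrightarrow>
      p s * n + q s \<le> i * n + j"
proof -
  let ?f = "\<lambda>l x. T l (x div n) (x mod n)"
  have indep: "\<forall>v. (\<forall>x<n * n. (\<Sum>l<n. v l * ?f l x) = 0) \<longrightarrow> (\<forall>l<n. v l = 0)"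
  proof (intro allI impI)
    fix v l assume v: "\<forall>x<n * n. (\<Sum>l<n. v l * ?f l x) = 0" and "l < n"
    have "(\<Sum>l<n. v l * T l j k) = 0" if "j < n" "k < n" for j k
      using v[rule_format, of "j * n + k"] that index_pair_less[of j n k n] by simp
    then show "v l = 0" using assms \<open>l < n\<close> unfolding slices_independent_def by blast
  qed
  obtain G pos where *: "inj_on pos {..<n}" "\<And>s. s < n \<Longrightarrow> pos s < n * n"
    "\<And>s. s < n \<Longrightarrow> (\<Sum>l<n. G s l * ?f l (pos s)) \<noteq> 0"
    "\<And>s x. s < n \<Longrightarrow> x < pos s \<Longrightarrow> (\<Sum>l<n. G s l * ?f l x) = 0"
    by (rule echelon_form[OF indep]) (rule that)
  show thesis
  proof (rule that)
    show "inj_on (\<lambda>s. (pos s div n, pos s mod n)) {..<n}"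
      using *(1) unfolding inj_on_def by (metis div_mult_mod_eq prod.inject)
    fix s assume s: "s < n"
    show "pos s div n < n" using *(2)[OF s] by (rule less_mult_imp_div_less)
    show "pos s mod n < n" using s by simp
    show "(\<Sum>l<n. G s l * T l (pos s div n) (pos s mod n)) \<noteq> 0" by (rule *(3)[OF s])
    fix i j assume "i < n" "j < n" "(\<Sum>l<n. G s l * T l i j) \<noteq> 0"
    then have "\<not> i * n + j < pos s" using *(4)[OF s, of "i * n + j"] by auto
    then show "pos s div n * n + pos s mod n \<le> i * n + j" by simp
  qed
qed

section \<open>Diagonals from degenerations\<close>

text \<open>A tensor power of \<open>S\<close> indexed by lists; the exponent is the common length
  of the lists.\<close>

definition list_power :: "('i \<Rightarrow> 'i \<Rightarrow> 'i \<Rightarrow> 'a::field) \<Rightarrow> 'i list \<Rightarrow> 'i list \<Rightarrow> 'i list \<Rightarrow> 'a" where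
  "list_power S xs ys zs = (\<Prod>t<length xs. S (xs ! t) (ys ! t) (zs ! t))"

lemma restriction_list_power:
  assumes "finite I" and "restriction {..<n ^ k} (kronecker_power n T k) I S"
  shows "restriction {..<n ^ (K * k)} (kronecker_power n T (K * k))
    {xs. set xs \<subseteq> I \<and> length xs = K} (list_power S)"
proof (induction K)
  case 0
  show ?case
    by (rule restriction_select[where f = "\<lambda>_. 0" and g = "\<lambda>_. 0" and h = "\<lambda>_. 0" and \<alpha> = "\<lambda>_. 1"])
      (auto simp: list_power_def unit_tensor_def)
next
  case (Suc K)
  let ?L = "\<lambda>K. {xs. set xs \<subseteq> I \<and> length xs = K}"
  let ?f = "\<lambda>xs. (hd xs, tl xs)"
  have "restriction (I \<times> ?L K) (tensor_prod S (list_power S)) (?L (Suc K)) (list_power S)"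
  proof (rule restriction_select[where f = ?f and g = ?f and h = ?f and \<alpha> = "\<lambda>_. 1"])
    show "finite (I \<times> ?L K)"
      using assms(1) by (simp add: finite_lists_length_eq)
    have im: "?f xs \<in> I \<times> ?L K" if "xs \<in> ?L (Suc K)" for xs
      using that by (cases xs) auto
    show "?f ` ?L (Suc K) \<subseteq> I \<times> ?L K" "?f ` ?L (Suc K) \<subseteq> I \<times> ?L K"
      "?f ` ?L (Suc K) \<subseteq> I \<times> ?L K"
      using im by blast+
    fix xs ys zs assume "xs \<in> ?L (Suc K)" "ys \<in> ?L (Suc K)" "zs \<in> ?L (Suc K)"
    then show "list_power S xs ys zs = 1 * tensor_prod S (list_power S) (?f xs) (?f ys) (?f zs)"
      by (cases xs; cases ys; cases zs)
        (auto simp: list_power_def tensor_prod_def prod.lessThan_Suc_shift simp del: prod.lessThan_Suc)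
  qed
  then show ?case
    using restriction_trans[OF restriction_kronecker_power_add
        restriction_trans[OF restriction_tensor_prod[OF assms(2) Suc]]]
    by simp
qed

text \<open>A multiset is determined by its multiplicities, which lie between \<open>0\<close> and
  \<open>K\<close>. For fixed \<open>A\<close> the bound is polynomial in \<open>K\<close>.\<close>

lemma card_mset_lists:
  assumes "finite A"
  shows "card (mset ` {xs. set xs \<subseteq> A \<and> length xs = K}) \<le> (K + 1) ^ card A"
proof -
  let ?L = "{xs. set xs \<subseteq> A \<and> length xs = K}"
  let ?c = "\<lambda>M. restrict (count M) A"
  have "inj_on ?c (mset ` ?L)"
  proof (rule inj_onI, rule multiset_eqI)
    fix M N x assume MN: "M \<in> mset ` ?L" "N \<in> mset ` ?L" and eq: "?c M = ?c N"
    show "count M x = count N x"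
    proof (cases "x \<in> A")
      case True
      then show ?thesis using fun_cong[OF eq, of x] by simp
    next
      case False
      then have "x \<notin># M" "x \<notin># N" using MN by auto
      then show ?thesis by (simp add: not_in_iff)
    qed
  qed
  moreover have "?c ` mset ` ?L \<subseteq> A \<rightarrow>\<^sub>E {..K}"
    by (auto simp: count_mset intro: order_trans[OF count_le_length])
  ultimately have "card (mset ` ?L) \<le> card (A \<rightarrow>\<^sub>E {..K})"
    using assms by (intro card_inj_on_le) (auto intro: finite_PiE)
  then show ?thesis using assms by (simp add: card_PiE)
qed

lemma sum_nth_eq_mset:
  assumes "mset xs = mset ys"
  shows "(\<Sum>t<length xs. f (xs ! t)) = (\<Sum>t<length ys. f (ys ! t) :: 'b::comm_monoid_add)"
proof -
  have "sum_list (map f zs) = (\<Sum>t<length zs. f (zs ! t))" for zs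
    by (simp add: sum_list_sum_nth lessThan_atLeast0)
  then show ?thesis using assms by (metis mset_map sum_mset_sum_list)
qed

text \<open>
  On the tuples of elements of \<open>Z\<close> with a prescribed multiset of entries, each of the sums of
  \<open>u\<close>, \<open>v\<close>, \<open>w\<close> is constant, so a nonzero entry of the restricted power has total
  weight \<open>0\<close>, which forces every coordinate into \<open>Z\<close>. Only polynomially many multisets
  compete.
\<close>

lemma degeneration_unit:
  fixes S :: "'i \<Rightarrow> 'i \<Rightarrow> 'i \<Rightarrow> 'a::field" and u v w u' v' w' :: "'i \<Rightarrow> int"
  assumes "finite I" and ZI: "Z \<subseteq> I \<times> I \<times> I" and "Z \<noteq> {}"
    and inj: "inj_on fst Z" "inj_on (\<lambda>z. fst (snd z)) Z" "inj_on (\<lambda>z. snd (snd z)) Z"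
    and Z: "\<And>x y z. (x, y, z) \<in> Z \<Longrightarrow>
      S x y z \<noteq> 0 \<and> u x + v y + w z = 0 \<and> u' x + v' y + w' z = 0"
    and supp: "\<And>x y z. x \<in> fst ` Z \<Longrightarrow> y \<in> (\<lambda>z. fst (snd z)) ` Z \<Longrightarrow>
      z \<in> (\<lambda>z. snd (snd z)) ` Z \<Longrightarrow> S x y z \<noteq> 0 \<Longrightarrow> u x + v y + w z \<ge> 0 \<and>
        (u x + v y + w z = 0 \<longrightarrow> u' x + v' y + w' z \<ge> 0 \<and>
          (u' x + v' y + w' z = 0 \<longrightarrow> (x, y, z) \<in> Z))"
  obtains r where "restriction {xs. set xs \<subseteq> I \<and> length xs = K} (list_power S) {..<r} unit_tensor"
    and "card Z ^ K \<le> r * (K + 1) ^ card Z"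
proof -
  have "finite Z" using ZI assms(1) by (meson finite_SigmaI finite_subset)
  define W where "W = {zs. set zs \<subseteq> Z \<and> length zs = K}"
  have "finite W" and cW: "card W = card Z ^ K"
    using \<open>finite Z\<close> by (simp_all add: W_def finite_lists_length_eq card_lists_length_eq)
  have "W \<noteq> {}"
    using cW \<open>Z \<noteq> {}\<close> \<open>finite Z\<close> by (metis card.empty card_gt_0_iff power_not_zero)
  \<comment> \<open>A multiset \<open>m\<close> shared by at least the average number of
    lists.\<close>
  obtain m where m: "card W \<le> card (mset -` {m} \<inter> W) * card (mset ` W)"
    using pigeonhole_card[of mset W "mset ` W"] \<open>finite W\<close> \<open>W \<noteq> {}\<close> by auto
  define F where "F = mset -` {m} \<inter> W"
  have "finite F" using \<open>finite W\<close> by (simp add: F_def)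
  then obtain e where e: "bij_betw e {..<card F} F"
    by (metis ex_bij_betw_nat_finite lessThan_atLeast0)
  have eF: "e a \<in> F" if "a < card F" for a
    using e that by (auto simp: bij_betw_def)
  have len: "length (e a) = K" and eZ: "\<And>t. t < K \<Longrightarrow> e a ! t \<in> Z" and me: "mset (e a) = m"
    if "a < card F" for a
    using eF[OF that] by (auto simp: F_def W_def)
  let ?f = "\<lambda>a. map fst (e a)" and ?g = "\<lambda>a. map (\<lambda>z. fst (snd z)) (e a)"
    and ?h = "\<lambda>a. map (\<lambda>z. snd (snd z)) (e a)"
  \<comment> \<open>Diagonal entries are nonzero but otherwise arbitrary; this factor scales them to
    \<open>1\<close>.\<close>
  let ?\<alpha> = "\<lambda>a. inverse (list_power S (?f a) (?g a) (?h a))"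
  have "restriction {xs. set xs \<subseteq> I \<and> length xs = K} (list_power S) {..<card F} unit_tensor"
  proof (rule restriction_select[where f = ?f and g = ?g and h = ?h and \<alpha> = ?\<alpha>])
    show "finite {xs. set xs \<subseteq> I \<and> length xs = K}"
      using assms(1) by (simp add: finite_lists_length_eq)
    have sub: "set (e a) \<subseteq> I \<times> I \<times> I" "length (e a) = K" if "a < card F" for a
      using eF[OF that] ZI by (auto simp: F_def W_def)
    show "?f ` {..<card F} \<subseteq> {xs. set xs \<subseteq> I \<and> length xs = K}"
      "?g ` {..<card F} \<subseteq> {xs. set xs \<subseteq> I \<and> length xs = K}"
      "?h ` {..<card F} \<subseteq> {xs. set xs \<subseteq> I \<and> length xs = K}"
      using sub by fastforce+
    fix a b c assume "a \<in> {..<card F}" "b \<in> {..<card F}" "c \<in> {..<card F}"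
    then have abc: "a < card F" "b < card F" "c < card F" by auto
    have lp: "list_power S (?f a) (?g b) (?h c) =
        (\<Prod>t<K. S (fst (e a ! t)) (fst (snd (e b ! t))) (snd (snd (e c ! t))))"
      if "a < card F" "b < card F" "c < card F" for a b c
      using that len by (simp add: list_power_def)
    have nz: "list_power S (?f a) (?g a) (?h a) \<noteq> 0"
      unfolding lp[OF abc(1) abc(1) abc(1)] using Z eZ[OF abc(1)]
      by (auto simp: prod.collapse)
    have diag: "a = b \<and> b = c" if ne: "list_power S (?f a) (?g b) (?h c) \<noteq> 0"
    proof -
      define x y z where "x t = fst (e a ! t)" and "y t = fst (snd (e b ! t))"
        and "z t = snd (snd (e c ! t))" for t
      have S: "S (x t) (y t) (z t) \<noteq> 0" if "t < K" for t
        using ne that unfolding lp[OF abc] x_def y_def z_def by simp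
      note supp' = supp[OF imageI[OF eZ[OF abc(1)]] imageI[OF eZ[OF abc(2)]] imageI[OF eZ[OF abc(3)]],
          folded x_def y_def z_def, OF _ _ _ S]
      \<comment> \<open>The lists \<open>e a\<close>, \<open>e b\<close>, \<open>e c\<close> have
        the same multiset, so the sums over \<open>e b\<close> and \<open>e c\<close> may be taken
        over \<open>e a\<close> instead; then every summand is the weight of an element of
        \<open>Z\<close>.\<close>
      have total: "(\<Sum>t<K. \<alpha> (x t) + \<beta> (y t) + \<gamma> (z t)) = 0"
        if "\<And>x y z. (x, y, z) \<in> Z \<Longrightarrow> \<alpha> x + \<beta> y + \<gamma> z = (0::int)" for \<alpha> \<beta> \<gamma>
      proof -
        have perm: "(\<Sum>t<K. k (e b ! t)) = (\<Sum>t<K. k (e a ! t))" if "b < card F" for k :: "_ \<Rightarrow> int" and b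
          using sum_nth_eq_mset[of "e b" "e a" k] that abc(1) len me by simp
        have "(\<Sum>t<K. \<alpha> (x t) + \<beta> (y t) + \<gamma> (z t)) =
          (\<Sum>t<K. \<alpha> (fst (e a ! t)) + \<beta> (fst (snd (e a ! t))) + \<gamma> (snd (snd (e a ! t))))"
          unfolding sum.distrib x_def y_def z_def
          using perm[OF abc(2), of "\<lambda>z. \<beta> (fst (snd z))"] perm[OF abc(3), of "\<lambda>z. \<gamma> (snd (snd z))"]
          by simp
        also have "\<dots> = 0"
          using that eZ[OF abc(1)] by (intro sum.neutral) (auto simp: prod.collapse)
        finally show ?thesis .
      qed
      have "(\<Sum>t<K. u (x t) + v (y t) + w (z t)) = 0"
        using Z by (intro total) blast
      then have 1: "u (x t) + v (y t) + w (z t) = 0" if "t < K" for t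
        using supp' that by (subst (asm) sum_nonneg_eq_0_iff) auto
      \<comment> \<open>The second weight is known to be nonnegative only where the first vanishes,
        hence the separate second round.\<close>
      have "(\<Sum>t<K. u' (x t) + v' (y t) + w' (z t)) = 0"
        using Z by (intro total) blast
      then have 2: "u' (x t) + v' (y t) + w' (z t) = 0" if "t < K" for t
        using supp' 1 that by (subst (asm) sum_nonneg_eq_0_iff) auto
      have mem: "(x t, y t, z t) \<in> Z" if "t < K" for t
        using supp' 1 2 that by blast
      \<comment> \<open>The triple shares its first coordinate with \<open>e a ! t\<close>, its
        second with \<open>e b ! t\<close> and its third with \<open>e c ! t\<close>; injectivity of
        the coordinates on \<open>Z\<close> identifies all of them.\<close>
      have "e a ! t = (x t, y t, z t)" if "t < K" for t
        by (rule inj_onD[OF inj(1) _ eZ[OF abc(1) that] mem[OF that]]) (simp add: x_def)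
      moreover have "e b ! t = (x t, y t, z t)" if "t < K" for t
        by (rule inj_onD[OF inj(2) _ eZ[OF abc(2) that] mem[OF that]]) (simp add: y_def)
      moreover have "e c ! t = (x t, y t, z t)" if "t < K" for t
        by (rule inj_onD[OF inj(3) _ eZ[OF abc(3) that] mem[OF that]]) (simp add: z_def)
      ultimately have "e a = e b" "e b = e c"
        using abc len by (auto intro!: nth_equalityI)
      then show ?thesis
        using e abc by (auto simp: bij_betw_def dest: inj_onD)
    qed
    show "unit_tensor a b c = ?\<alpha> a * list_power S (?f a) (?g b) (?h c)"
      using nz diag by (auto simp: unit_tensor_def)
  qed
  moreover have "card Z ^ K \<le> card F * (K + 1) ^ card Z"
    using m card_mset_lists[OF \<open>finite Z\<close>, of K]
    unfolding cW F_def[symmetric] W_def[symmetric] by (meson mult_le_mono2 order_trans)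
  ultimately show thesis using that by blast
qed

text \<open>For fixed \<open>Z\<close> the loss is polynomial in \<open>K\<close>, so asymptotically
  the degeneration counts like a diagonal of size \<open>card Z\<close> in the \<open>k\<close>-th
  power.\<close>

lemma degeneration_subrank:
  fixes S :: "'i \<Rightarrow> 'i \<Rightarrow> 'i \<Rightarrow> 'a::field" and u v w u' v' w' :: "'i \<Rightarrow> int"
  assumes "restriction {..<n ^ k} (kronecker_power n T k) I S"
    and "finite I" and "Z \<subseteq> I \<times> I \<times> I" and "Z \<noteq> {}"
    and "inj_on fst Z" "inj_on (\<lambda>z. fst (snd z)) Z" "inj_on (\<lambda>z. snd (snd z)) Z"
    and "\<And>x y z. (x, y, z) \<in> Z \<Longrightarrow>
      S x y z \<noteq> 0 \<and> u x + v y + w z = 0 \<and> u' x + v' y + w' z = 0"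
    and "\<And>x y z. x \<in> fst ` Z \<Longrightarrow> y \<in> (\<lambda>z. fst (snd z)) ` Z \<Longrightarrow>
      z \<in> (\<lambda>z. snd (snd z)) ` Z \<Longrightarrow> S x y z \<noteq> 0 \<Longrightarrow> u x + v y + w z \<ge> 0 \<and>
        (u x + v y + w z = 0 \<longrightarrow> u' x + v' y + w' z \<ge> 0 \<and>
          (u' x + v' y + w' z = 0 \<longrightarrow> (x, y, z) \<in> Z))"
  shows "card Z ^ K \<le> subrank (n ^ (K * k)) (kronecker_power n T (K * k)) * (K + 1) ^ card Z"
proof -
  obtain r where r: "restriction {xs. set xs \<subseteq> I \<and> length xs = K} (list_power S) {..<r} unit_tensor"
    and le: "card Z ^ K \<le> r * (K + 1) ^ card Z"
    by (rule degeneration_unit[OF assms(2-9)])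
  have "r \<le> subrank (n ^ (K * k)) (kronecker_power n T (K * k))"
    by (rule restriction_subrank[OF restriction_trans[OF restriction_list_power[OF assms(2,1)] r]])
  then show ?thesis using le by (meson mult_le_mono1 order_trans)
qed

section \<open>Large diagonals in powers of a symmetric tensor\<close>

text \<open>The number \<open>s\<close> stands for the edge \<open>(p s, q s)\<close>. The bounds by
  \<open>\<surd>N\<close> and \<open>N * \<surd>N\<close> are squared to remain in the natural
  numbers.\<close>

lemma matching_dichotomy:
  fixes p q :: "nat \<Rightarrow> nat"
  obtains (matching) M where "M \<subseteq> {..<N}" and "inj_on p M" and "inj_on q M" and "N \<le> card M ^ 2"
  | (cover) E where "E \<subseteq> {..<N}" and "N \<le> 2 * card E"
      and "(card (p ` E) * card (q ` E)) ^ 2 \<le> N ^ 3"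
proof -
  let ?\<M> = "{M. M \<subseteq> {..<N} \<and> inj_on p M \<and> inj_on q M}"
  have "finite ?\<M>" by (rule finite_subset[of _ "Pow {..<N}"]) auto
  moreover have "{} \<in> ?\<M>" by simp
  ultimately obtain M where M: "M \<in> ?\<M>" and max: "\<And>M'. M' \<in> ?\<M> \<Longrightarrow> M \<subseteq> M' \<Longrightarrow> M = M'"
    using finite_has_maximal[of ?\<M>] by (metis (no_types, lifting) empty_iff)
  have "finite M" using M finite_subset by auto
  let ?E1 = "{s \<in> {..<N}. p s \<in> p ` M}" and ?E2 = "{s \<in> {..<N}. q s \<in> q ` M}"
  have "s \<in> ?E1 \<union> ?E2" if "s < N" for s
  proof (rule ccontr)
    assume *: "s \<notin> ?E1 \<union> ?E2"
    then have "insert s M \<in> ?\<M>" using M that by (auto simp: inj_on_insert)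
    then have "s \<in> M" using max[of "insert s M"] by blast
    then show False using * that by blast
  qed
  then have "{..<N} \<subseteq> ?E1 \<union> ?E2" by blast
  then have "card {..<N} \<le> card (?E1 \<union> ?E2)" by (intro card_mono) auto
  then have cards: "N \<le> card ?E1 + card ?E2"
    using card_Un_le[of ?E1 ?E2] by simp
  have sub: "card E \<le> N" if "E \<subseteq> {..<N}" for E
    using card_mono[OF _ that] by simp
  show thesis
  proof (cases "N \<le> card M ^ 2")
    case True
    then show thesis using M by (intro matching) auto
  next
    case False
    \<comment> \<open>Here \<open>x\<close> counts endpoints on the side covered by the matching,
      fewer than \<open>\<surd>N\<close>, and \<open>y\<close> those on the other side.\<close>
    have bound: "(x * y) ^ 2 \<le> N ^ 3" if "x \<le> card M" "y \<le> N" for x y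
    proof -
      have "(x * y) ^ 2 \<le> card M ^ 2 * N ^ 2"
        using that by (simp add: power_mult_distrib mult_le_mono power_mono)
      also have "\<dots> \<le> N * N ^ 2" using False by (intro mult_le_mono1) simp
      finally show ?thesis by (simp add: power2_eq_square power3_eq_cube)
    qed
    have img: "card (p ` ?E1) \<le> card M" "card (q ` ?E2) \<le> card M"
      using card_mono[of "p ` M" "p ` ?E1"] card_mono[of "q ` M" "q ` ?E2"]
        card_image_le[of M p] card_image_le[of M q] \<open>finite M\<close>
      by (auto intro: order_trans)
    have img': "card (q ` ?E1) \<le> N" "card (p ` ?E2) \<le> N"
      using card_image_le[of ?E1 q] card_image_le[of ?E2 p] sub[of ?E1] sub[of ?E2]
      by (auto intro: order_trans)
    show thesis
    proof (cases "N \<le> 2 * card ?E1")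
      case True
      then show thesis
        using bound[OF img(1) img'(1)] by (intro cover[of ?E1]) auto
    next
      case False
      then have "N \<le> 2 * card ?E2" using cards by linarith
      then show thesis
        using bound[OF img(2) img'(2)] by (intro cover[of ?E2]) (auto simp: mult.commute)
    qed
  qed
qed

text \<open>Number the endpoints on each side from \<open>0\<close>. A sum of three labels is less
  than three times the number of endpoints, which gives the factor \<open>9 = 3 * 3\<close> in the
  pigeonhole bound. Labels are integers because they enter weights with signs.\<close>

lemma popular_sums:
  fixes p q :: "'e \<Rightarrow> 'x"
  assumes "finite E" and "E \<noteq> {}"
  obtains \<kappa> \<rho> :: "'x \<Rightarrow> int" and a b where "inj_on \<kappa> (p ` E)" and "inj_on \<rho> (q ` E)"
    and "card E ^ 3 \<le> card {(e1, e2, e3) \<in> E \<times> E \<times> E. \<kappa> (p e1) + \<kappa> (p e2) + \<kappa> (p e3) = a \<and>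
       \<rho> (q e1) + \<rho> (q e2) + \<rho> (q e3) = b} * (9 * (card (p ` E) * card (q ` E)))"
proof -
  obtain f where f: "bij_betw f (p ` E) {0..<card (p ` E)}"
    using ex_bij_betw_finite_nat[of "p ` E"] assms(1) by blast
  obtain g where g: "bij_betw g (q ` E) {0..<card (q ` E)}"
    using ex_bij_betw_finite_nat[of "q ` E"] assms(1) by blast
  have fE: "f (p e) < card (p ` E)" and gE: "g (q e) < card (q ` E)" if "e \<in> E" for e
    using f g that by (auto simp: bij_betw_def)
  let ?F = "\<lambda>(e1, e2, e3). (f (p e1) + f (p e2) + f (p e3), g (q e1) + g (q e2) + g (q e3))"
  let ?B = "{..<3 * card (p ` E)} \<times> {..<3 * card (q ` E)}"
  have F: "?F \<in> E \<times> E \<times> E \<rightarrow> ?B"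
  proof (rule funcsetI)
    fix z assume "z \<in> E \<times> E \<times> E"
    then obtain e1 e2 e3 where "z = (e1, e2, e3)" "e1 \<in> E" "e2 \<in> E" "e3 \<in> E" by auto
    then show "?F z \<in> ?B"
      using fE[of e1] fE[of e2] fE[of e3] gE[of e1] gE[of e2] gE[of e3] by simp
  qed
  moreover have "?B \<noteq> {}"
    using assms by (simp add: card_gt_0_iff lessThan_empty_iff)
  ultimately obtain a b where ab:
    "card (E \<times> E \<times> E) \<le> card (?F -` {(a, b)} \<inter> E \<times> E \<times> E) * card ?B"
    using pigeonhole_card[of ?F "E \<times> E \<times> E" ?B] assms(1) by auto
  have "?F -` {(a, b)} \<inter> E \<times> E \<times> E =
    {(e1, e2, e3) \<in> E \<times> E \<times> E. int (f (p e1)) + int (f (p e2)) + int (f (p e3)) = int a \<and>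
       int (g (q e1)) + int (g (q e2)) + int (g (q e3)) = int b}"
    by (auto simp flip: of_nat_add)
  moreover have "inj_on (\<lambda>x. int (f x)) (p ` E)" "inj_on (\<lambda>x. int (g x)) (q ` E)"
    using f g by (auto simp: bij_betw_def inj_on_def)
  ultimately show thesis
    using ab by (intro that[of "\<lambda>x. int (f x)" "\<lambda>x. int (g x)" "int a" "int b"])
      (auto simp: card_cartesian_product power3_eq_cube ac_simps)
qed

section \<open>Degenerations of the echelon form\<close>

lemma digits_eq_iff:
  fixes i j i' j' n :: nat
  assumes "j < n" and "j' < n"
  shows "i * n + j = i' * n + j' \<longleftrightarrow> i = i' \<and> j = j'"
proof
  assume eq: "i * n + j = i' * n + j'"
  have "i = (i * n + j) div n" "j = (i * n + j) mod n" using assms by auto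
  moreover have "i' = (i * n + j) div n" "j' = (i * n + j) mod n" using assms unfolding eq by auto
  ultimately show "i = i' \<and> j = j'" by simp
qed simp

text \<open>\<open>S\<close> is the \<open>m\<close>-th power with its slices along the first leg in
  echelon form: slice \<open>s\<close> has its lexicographically first nonzero entry at
  \<open>(p s, q s)\<close>.\<close>

locale echelon_tensor =
  fixes n m :: nat and T S :: "'a::field tensor3" and p q :: "nat \<Rightarrow> nat" and N :: nat
  assumes N: "N = n ^ m" "N > 0"
    and symmetric: "symmetric_tensor n T"
    and restriction: "restriction {..<N} (kronecker_power n T m) {..<N} S"
    and inj_pos: "inj_on (\<lambda>s. (p s, q s)) {..<N}"
    and pos_less: "\<And>s. s < N \<Longrightarrow> p s < N" "\<And>s. s < N \<Longrightarrow> q s < N"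
    and leading: "\<And>s. s < N \<Longrightarrow> S s (p s) (q s) \<noteq> 0"
    and leading_le: "\<And>s i j. s < N \<Longrightarrow> i < N \<Longrightarrow> j < N \<Longrightarrow> S s i j \<noteq> 0 \<Longrightarrow>
      p s * N + q s \<le> i * N + j"
begin

lemma leading_eq:
  assumes "s < N" "i < N" "j < N" "i * N + j = p s * N + q s"
  shows "i = p s" "j = q s"
  using assms pos_less digits_eq_iff by blast+

text \<open>The weight of the entry \<open>(s, i, j)\<close> is the excess of
  \<open>i * N + j\<close> over the leading position of slice \<open>s\<close>. It splits over the
  legs, is nonnegative on the support and vanishes only at leading entries, so the second weights
  can be zero. The matching property makes these entries a diagonal.\<close>

lemma subrank_matching:
  assumes M: "M \<subseteq> {..<N}" and "M \<noteq> {}" and inj: "inj_on p M" "inj_on q M"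
  shows "card M ^ K \<le> subrank (n ^ (K * m)) (kronecker_power n T (K * m)) * (K + 1) ^ card M"
proof -
  let ?Z = "(\<lambda>s. (s, p s, q s)) ` M"
  have "card ?Z ^ K \<le> subrank (n ^ (K * m)) (kronecker_power n T (K * m)) * (K + 1) ^ card ?Z"
  proof (rule degeneration_subrank[where S = S and I = "{..<N}"
        and u = "\<lambda>s. - int (p s * N + q s)" and v = "\<lambda>i. int (i * N)" and w = int
        and u' = "\<lambda>_. 0" and v' = "\<lambda>_. 0" and w' = "\<lambda>_. 0"])
    show "restriction {..<n ^ m} (kronecker_power n T m) {..<N} S"
      using restriction by (simp add: N)
    show "?Z \<subseteq> {..<N} \<times> {..<N} \<times> {..<N}" using M pos_less by auto
    show "inj_on fst ?Z" "inj_on (\<lambda>z. fst (snd z)) ?Z" "inj_on (\<lambda>z. snd (snd z)) ?Z"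
      using inj by (auto simp: inj_on_def)
    fix x y z
    show "(x, y, z) \<in> ?Z \<Longrightarrow> S x y z \<noteq> 0 \<and>
        - int (p x * N + q x) + int (y * N) + int z = 0 \<and> 0 + 0 + 0 = (0::int)"
      using M leading by auto
    assume xyz: "x \<in> fst ` ?Z" "y \<in> (\<lambda>z. fst (snd z)) ` ?Z" "z \<in> (\<lambda>z. snd (snd z)) ` ?Z" "S x y z \<noteq> 0"
    then have x: "x \<in> M" "x < N" "y < N" "z < N" using M pos_less by auto
    have "p x * N + q x \<le> y * N + z" using leading_le x xyz(4) by blast
    moreover have "(x, y, z) \<in> ?Z" if "y * N + z = p x * N + q x"
      using leading_eq[OF x(2-4) that] x(1) by auto
    ultimately show "- int (p x * N + q x) + int (y * N) + int z \<ge> 0 \<and>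
        (- int (p x * N + q x) + int (y * N) + int z = 0 \<longrightarrow> (0::int) + 0 + 0 \<ge> 0 \<and>
          ((0::int) + 0 + 0 = 0 \<longrightarrow> (x, y, z) \<in> ?Z))"
      by linarith
  qed (use \<open>M \<noteq> {}\<close> in auto)
  moreover have "card ?Z = card M"
    by (intro card_image) (auto simp: inj_on_def)
  ultimately show ?thesis by simp
qed

text \<open>The rotations put the slice index of each factor on a different leg: the entry at
  \<open>(e1, j2, i3)\<close>, \<open>(i1, e2, j3)\<close>, \<open>(j1, i2, e3)\<close> is
  \<open>S e1 i1 j1 * S e2 i2 j2 * S e3 i3 j3\<close>.\<close>

abbreviation (input) cyclic :: "nat \<times> nat \<times> nat \<Rightarrow> nat \<times> nat \<times> nat \<Rightarrow> nat \<times> nat \<times> nat \<Rightarrow> 'a" where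
  "cyclic \<equiv> tensor_prod S (tensor_prod (\<lambda>x y z. S y z x) (\<lambda>x y z. S z x y))"

text \<open>A rotation of the symmetric \<open>m\<close>-th power is the power itself, so it also
  restricts to the rotations of \<open>S\<close>.\<close>

lemma restriction_cyclic:
  "restriction {..<n ^ (m + (m + m))} (kronecker_power n T (m + (m + m)))
     ({..<N} \<times> {..<N} \<times> {..<N}) cyclic"
proof -
  let ?T = "kronecker_power n T m"
  have rot: "?T y z x = ?T x y z" if "x < N" "y < N" "z < N" for x y z
    using kronecker_power_swap[OF symmetric, of _ m] that unfolding N by metis
  have 1: "restriction {..<n ^ m} ?T {..<N} S"
    using restriction by (simp add: N)
  have 2: "restriction {..<n ^ m} ?T {..<N} (\<lambda>x y z. S y z x)"
    using restriction_rotate[OF restriction] rot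
    by (subst restriction_cong[where S' = "\<lambda>x y z. ?T y z x"]) (auto simp: N)
  have 3: "restriction {..<n ^ m} ?T {..<N} (\<lambda>x y z. S z x y)"
    using restriction_rotate[OF restriction_rotate[OF restriction]] rot
    by (subst restriction_cong[where S' = "\<lambda>x y z. ?T z x y"]) (auto simp: N)
  show ?thesis
    by (rule restriction_trans[OF restriction_kronecker_power_add
        restriction_tensor_prod[OF 1 restriction_trans[OF restriction_kronecker_power_add
        restriction_tensor_prod[OF 2 3]]]])
qed

text \<open>The first weight confines the support to the leading entries of all three factors, that
  is, to triples of edges. On these the second weight is a sum of two squares that vanishes exactly
  on \<open>Y\<close>.\<close>

lemma subrank_cyclic:
  fixes \<kappa> \<rho> :: "nat \<Rightarrow> int"
  assumes E: "E \<subseteq> {..<N}" and inj: "inj_on \<kappa> (p ` E)" "inj_on \<rho> (q ` E)"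
    and Y: "Y = {(e1, e2, e3) \<in> E \<times> E \<times> E. \<kappa> (p e1) + \<kappa> (p e2) + \<kappa> (p e3) = a \<and>
       \<rho> (q e1) + \<rho> (q e2) + \<rho> (q e3) = b}" and "Y \<noteq> {}"
  shows "card Y ^ K \<le> subrank (n ^ (K * (m + (m + m)))) (kronecker_power n T (K * (m + (m + m))))
    * (K + 1) ^ card Y"
proof -
  \<comment> \<open>Each leg shows one edge completely, another by its left and the third by its
    right endpoint.\<close>
  let ?\<phi> = "\<lambda>(e1, e2, e3). ((e1, q e2, p e3), (p e1, e2, q e3), (q e1, p e2, e3))"
  let ?Z = "?\<phi> ` Y"
  let ?f = "\<lambda>s. int (p s * N + q s)"
  \<comment> \<open>The excesses over the leading positions in the three factors, added up and
    regrouped by legs.\<close>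
  let ?u = "\<lambda>(e1, j2, i3). - ?f e1 + int j2 + int (i3 * N)"
    and ?v = "\<lambda>(i1, e2, j3). int (i1 * N) - ?f e2 + int j3"
    and ?w = "\<lambda>(j1, i2, e3). int j1 + int (i2 * N) - ?f e3"
  \<comment> \<open>The squares of \<open>\<kappa> i1 + \<kappa> i2 + \<kappa> i3 - a\<close> and \<open>\<rho> j1 + \<rho> j2 + \<rho> j3 - b\<close>
    can be distributed over the legs because any two of the six indices occur together in some leg.\<close>
  let ?u' = "\<lambda>(e1, j2, i3). \<kappa> (p e1) ^ 2 + 2 * \<kappa> (p e1) * \<kappa> i3 - 2 * a * \<kappa> (p e1) + a ^ 2
      + (\<rho> (q e1) ^ 2 + 2 * \<rho> (q e1) * \<rho> j2 - 2 * b * \<rho> (q e1) + b ^ 2)"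
    and ?v' = "\<lambda>(i1, e2, j3). \<kappa> (p e2) ^ 2 + 2 * \<kappa> (p e2) * \<kappa> i1 - 2 * a * \<kappa> (p e2)
      + (\<rho> (q e2) ^ 2 + 2 * \<rho> (q e2) * \<rho> j3 - 2 * b * \<rho> (q e2))"
    and ?w' = "\<lambda>(j1, i2, e3). \<kappa> (p e3) ^ 2 + 2 * \<kappa> (p e3) * \<kappa> i2 - 2 * a * \<kappa> (p e3)
      + (\<rho> (q e3) ^ 2 + 2 * \<rho> (q e3) * \<rho> j1 - 2 * b * \<rho> (q e3))"
  have quad: "?u' (e1, q e2, p e3) + ?v' (p e1, e2, q e3) + ?w' (q e1, p e2, e3) =
    (\<kappa> (p e1) + \<kappa> (p e2) + \<kappa> (p e3) - a) ^ 2 + (\<rho> (q e1) + \<rho> (q e2) + \<rho> (q e3) - b) ^ 2"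
    for e1 e2 e3
    by (simp add: power2_eq_square algebra_simps)
  have Ymem: "e1 \<in> E \<and> e2 \<in> E \<and> e3 \<in> E \<and> \<kappa> (p e1) + \<kappa> (p e2) + \<kappa> (p e3) = a \<and>
      \<rho> (q e1) + \<rho> (q e2) + \<rho> (q e3) = b" if "(e1, e2, e3) \<in> Y" for e1 e2 e3
    using that Y by auto
  have EN: "e < N" "p e < N" "q e < N" if "e \<in> E" for e
    using that E pos_less by auto
  have determined: "s = s'" if "s \<in> E" "s' \<in> E" "\<kappa> (p s) = \<kappa> (p s')" "\<rho> (q s) = \<rho> (q s')" for s s'
  proof -
    have "p s = p s'" "q s = q s'"
      using inj that by (auto dest: inj_onD)
    then show ?thesis using inj_pos E that(1,2) by (auto dest: inj_onD)
  qed
  have "card ?Z ^ K \<le> subrank (n ^ (K * (m + (m + m)))) (kronecker_power n T (K * (m + (m + m))))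
    * (K + 1) ^ card ?Z"
  proof (rule degeneration_subrank[where S = cyclic and I = "{..<N} \<times> {..<N} \<times> {..<N}"
        and u = ?u and v = ?v and w = ?w and u' = ?u' and v' = ?v' and w' = ?w'])
    show "restriction {..<n ^ (m + (m + m))} (kronecker_power n T (m + (m + m)))
       ({..<N} \<times> {..<N} \<times> {..<N}) cyclic"
      by (rule restriction_cyclic)
    show "?Z \<subseteq> ({..<N} \<times> {..<N} \<times> {..<N}) \<times> ({..<N} \<times> {..<N} \<times> {..<N}) \<times> ({..<N} \<times> {..<N} \<times> {..<N})"
      by (auto dest!: Ymem simp: EN)
    show "inj_on fst ?Z"
    proof (rule inj_on_imageI, rule inj_onI)
      fix t t' assume "t \<in> Y" "t' \<in> Y" and eq: "(fst \<circ> ?\<phi>) t = (fst \<circ> ?\<phi>) t'"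
      moreover obtain e1 e2 e3 e1' e2' e3' where e: "t = (e1, e2, e3)" "t' = (e1', e2', e3')"
        by (metis prod_cases3)
      ultimately have Y: "(e1, e2, e3) \<in> Y" "(e1', e2', e3') \<in> Y" by simp_all
      have eqs: "e1 = e1'" "q e2 = q e2'" "p e3 = p e3'"
        using eq unfolding e by simp_all
      \<comment> \<open>The leg gives both endpoints of \<open>e1\<close>, so the prescribed sums
        yield the missing left label of \<open>e2\<close> and right label of \<open>e3\<close>. The
        other legs behave alike.\<close>
      have "\<kappa> (p e2) = \<kappa> (p e2')" "\<rho> (q e3) = \<rho> (q e3')"
        using Ymem[OF Y(1)] Ymem[OF Y(2)] unfolding eqs by linarith+
      then have "e2 = e2'" "e3 = e3'"
        using Ymem[OF Y(1)] Ymem[OF Y(2)] eqs by (auto intro: determined)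
      then show "t = t'" using eqs e by simp
    qed
    show "inj_on (\<lambda>z. fst (snd z)) ?Z"
    proof (rule inj_on_imageI, rule inj_onI)
      fix t t' assume "t \<in> Y" "t' \<in> Y" and eq: "((\<lambda>z. fst (snd z)) \<circ> ?\<phi>) t = ((\<lambda>z. fst (snd z)) \<circ> ?\<phi>) t'"
      moreover obtain e1 e2 e3 e1' e2' e3' where e: "t = (e1, e2, e3)" "t' = (e1', e2', e3')"
        by (metis prod_cases3)
      ultimately have Y: "(e1, e2, e3) \<in> Y" "(e1', e2', e3') \<in> Y" by simp_all
      have eqs: "e2 = e2'" "p e1 = p e1'" "q e3 = q e3'"
        using eq unfolding e by simp_all
      have "\<kappa> (p e3) = \<kappa> (p e3')" "\<rho> (q e1) = \<rho> (q e1')"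
        using Ymem[OF Y(1)] Ymem[OF Y(2)] unfolding eqs by linarith+
      then have "e1 = e1'" "e3 = e3'"
        using Ymem[OF Y(1)] Ymem[OF Y(2)] eqs by (auto intro: determined)
      then show "t = t'" using eqs e by simp
    qed
    show "inj_on (\<lambda>z. snd (snd z)) ?Z"
    proof (rule inj_on_imageI, rule inj_onI)
      fix t t' assume "t \<in> Y" "t' \<in> Y" and eq: "((\<lambda>z. snd (snd z)) \<circ> ?\<phi>) t = ((\<lambda>z. snd (snd z)) \<circ> ?\<phi>) t'"
      moreover obtain e1 e2 e3 e1' e2' e3' where e: "t = (e1, e2, e3)" "t' = (e1', e2', e3')"
        by (metis prod_cases3)
      ultimately have Y: "(e1, e2, e3) \<in> Y" "(e1', e2', e3') \<in> Y" by simp_all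
      have eqs: "e3 = e3'" "q e1 = q e1'" "p e2 = p e2'"
        using eq unfolding e by simp_all
      have "\<kappa> (p e1) = \<kappa> (p e1')" "\<rho> (q e2) = \<rho> (q e2')"
        using Ymem[OF Y(1)] Ymem[OF Y(2)] unfolding eqs by linarith+
      then have "e1 = e1'" "e2 = e2'"
        using Ymem[OF Y(1)] Ymem[OF Y(2)] eqs by (auto intro: determined)
      then show "t = t'" using eqs e by simp
    qed
  next
    fix x y z assume "(x, y, z) \<in> ?Z"
    then obtain e1 e2 e3 where e: "(e1, e2, e3) \<in> Y" "x = (e1, q e2, p e3)"
      "y = (p e1, e2, q e3)" "z = (q e1, p e2, e3)"
      by auto
    have "?u' x + ?v' y + ?w' z = 0"
      unfolding e(2-4) quad using Ymem[OF e(1)] by simp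
    moreover have "?u x + ?v y + ?w z = 0" unfolding e(2-4) by simp
    moreover have "cyclic x y z \<noteq> 0"
      using Ymem[OF e(1)] E leading unfolding e(2-4) by (auto simp: tensor_prod_def)
    ultimately show "cyclic x y z \<noteq> 0 \<and> ?u x + ?v y + ?w z = 0 \<and> ?u' x + ?v' y + ?w' z = 0"
      by blast
  next
    \<comment> \<open>The three legs may now come from different elements of \<open>Y\<close>, so
      their entries need not match.\<close>
    fix x y z
    assume x: "x \<in> fst ` ?Z" and y: "y \<in> (\<lambda>z. fst (snd z)) ` ?Z"
      and z: "z \<in> (\<lambda>z. snd (snd z)) ` ?Z" and ne: "cyclic x y z \<noteq> 0"
    from x obtain e1 j2 i3 where x: "x = (e1, j2, i3)" "e1 \<in> E" "j2 < N" "i3 < N"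
      by (auto dest!: Ymem simp: EN)
    from y obtain i1 e2 j3 where y: "y = (i1, e2, j3)" "i1 < N" "e2 \<in> E" "j3 < N"
      by (auto dest!: Ymem simp: EN)
    from z obtain j1 i2 e3 where z: "z = (j1, i2, e3)" "j1 < N" "i2 < N" "e3 \<in> E"
      by (auto dest!: Ymem simp: EN)
    note e = x(1) y(1) z(1) and eE = x(2) y(3) z(4) and less = x(3,4) y(2,4) z(2,3)
    have eN: "e1 < N" "e2 < N" "e3 < N" using eE E by auto
    have "S e1 i1 j1 \<noteq> 0" "S e2 i2 j2 \<noteq> 0" "S e3 i3 j3 \<noteq> 0"
      using ne unfolding e by (auto simp: tensor_prod_def)
    then have le: "p e1 * N + q e1 \<le> i1 * N + j1" "p e2 * N + q e2 \<le> i2 * N + j2"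
      "p e3 * N + q e3 \<le> i3 * N + j3"
      using leading_le eN less by auto
    have sum: "?u x + ?v y + ?w z = (int (i1 * N + j1) - ?f e1) + (int (i2 * N + j2) - ?f e2)
        + (int (i3 * N + j3) - ?f e3)"
      unfolding e by simp
    have "?u' x + ?v' y + ?w' z \<ge> 0 \<and> (?u' x + ?v' y + ?w' z = 0 \<longrightarrow> (x, y, z) \<in> ?Z)"
      if "?u x + ?v y + ?w z = 0"
    proof -
      \<comment> \<open>Three nonnegative excesses with sum \<open>0\<close> vanish
        separately.\<close>
      have "i1 * N + j1 = p e1 * N + q e1" "i2 * N + j2 = p e2 * N + q e2"
        "i3 * N + j3 = p e3 * N + q e3"
        using that le unfolding sum by linarith+
      then have ij: "i1 = p e1" "j1 = q e1" "i2 = p e2" "j2 = q e2" "i3 = p e3" "j3 = q e3"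
        using leading_eq eN less by blast+
      have "(x, y, z) \<in> ?Z" if "(e1, e2, e3) \<in> Y"
        unfolding e ij by (rule image_eqI[OF _ that]) simp
      then show ?thesis
        unfolding e ij quad using eE by (auto simp: Y sum_power2_eq_zero_iff)
    qed
    then show "?u x + ?v y + ?w z \<ge> 0 \<and> (?u x + ?v y + ?w z = 0 \<longrightarrow>
        ?u' x + ?v' y + ?w' z \<ge> 0 \<and> (?u' x + ?v' y + ?w' z = 0 \<longrightarrow> (x, y, z) \<in> ?Z))"
      using le unfolding sum by linarith
  qed (use \<open>Y \<noteq> {}\<close> in auto)
  moreover have "card ?Z = card Y"
    by (intro card_image) (auto simp: inj_on_def)
  ultimately show ?thesis by simp
qed

text \<open>Here \<open>z\<close> is the size of the matching, with \<open>k = m\<close>, or of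
  \<open>Y\<close>, with \<open>k = m + (m + m)\<close>. Since \<open>5184 = 72 ^ 2\<close>, it is
  at least \<open>\<surd>(n ^ k) / 72\<close>; \<open>m \<le> k\<close> allows \<open>k\<close> to
  be made so large that this constant does not matter.\<close>

lemma subrank_lower_bound:
  obtains k z C where "m \<le> k" and "n ^ k \<le> 5184 * z ^ 2"
    and "\<And>K. z ^ K \<le> subrank (n ^ (K * k)) (kronecker_power n T (K * k)) * (K + 1) ^ C"
proof (rule matching_dichotomy[of N p q])
  fix M assume M: "M \<subseteq> {..<N}" "inj_on p M" "inj_on q M" "N \<le> card M ^ 2"
  then have "M \<noteq> {}" using N by auto
  then show thesis
    using subrank_matching[OF M(1) _ M(2,3)] M(4) N by (intro that[of m "card M" "card M"]) auto
next
  fix E assume E: "E \<subseteq> {..<N}" "N \<le> 2 * card E" "(card (p ` E) * card (q ` E)) ^ 2 \<le> N ^ 3"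
  have "finite E" using E(1) finite_subset by blast
  moreover have "E \<noteq> {}" using E(2) N by auto
  ultimately obtain \<kappa> \<rho> :: "nat \<Rightarrow> int" and a b
    where inj: "inj_on \<kappa> (p ` E)" "inj_on \<rho> (q ` E)"
    and card: "card E ^ 3 \<le> card {(e1, e2, e3) \<in> E \<times> E \<times> E.
       \<kappa> (p e1) + \<kappa> (p e2) + \<kappa> (p e3) = a \<and> \<rho> (q e1) + \<rho> (q e2) + \<rho> (q e3) = b}
       * (9 * (card (p ` E) * card (q ` E)))"
    by (rule popular_sums)
  define Y where "Y = {(e1, e2, e3) \<in> E \<times> E \<times> E.
       \<kappa> (p e1) + \<kappa> (p e2) + \<kappa> (p e3) = a \<and> \<rho> (q e1) + \<rho> (q e2) + \<rho> (q e3) = b}"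
  have "card E > 0" using E(2) N by linarith
  then have "Y \<noteq> {}" using card unfolding Y_def[symmetric] by auto
  let ?c = "card (p ` E) * card (q ` E)"
  \<comment> \<open>In \<open>72 = 8 * 9\<close>, the \<open>8\<close> is the cube of the
    \<open>2\<close> lost in passing to \<open>E\<close>, and the \<open>9\<close> comes from the
    pigeonhole. After squaring, the endpoint bound \<open>N ^ 3\<close> cancels.\<close>
  have "N ^ 3 \<le> (2 * card E) ^ 3" using E(2) by (rule power_mono) simp
  also have "\<dots> = 8 * card E ^ 3" by (simp add: power_mult_distrib)
  also have "\<dots> \<le> 8 * (card Y * (9 * ?c))" using card unfolding Y_def[symmetric] by simp
  finally have "(N ^ 3) ^ 2 \<le> (72 * card Y * ?c) ^ 2" by (intro power_mono) auto
  also have "\<dots> = 5184 * card Y ^ 2 * ?c ^ 2" by (simp add: power_mult_distrib)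
  also have "\<dots> \<le> 5184 * card Y ^ 2 * N ^ 3" using E(3) by (rule mult_le_mono2)
  finally have "N ^ 3 * N ^ 3 \<le> 5184 * card Y ^ 2 * N ^ 3"
    by (simp only: power2_eq_square[of "N ^ 3"])
  then have "N ^ 3 \<le> 5184 * card Y ^ 2"
    by (rule mult_right_le_imp_le) (simp add: N(2))
  moreover have "n ^ (m + (m + m)) = N ^ 3"
    by (simp add: N power_add power3_eq_cube)
  ultimately show thesis
    using subrank_cyclic[OF E(1) inj Y_def \<open>Y \<noteq> {}\<close>]
    by (intro that[of "m + (m + m)" "card Y" "card Y"]) simp_all
qed

end

lemma subrank_kronecker_power_lower_bound:
  fixes T :: "'a::field tensor3"
  assumes "symmetric_tensor n T" and "concise n T" and "n > 0"
  obtains k z C where "m \<le> k" and "n ^ k \<le> 5184 * z ^ 2"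
    and "\<And>K. z ^ K \<le> subrank (n ^ (K * k)) (kronecker_power n T (K * k)) * (K + 1) ^ C"
proof -
  let ?N = "n ^ m" and ?T = "kronecker_power n T m"
  have "slices_independent ?N ?T"
    by (intro slices_independent_kronecker_power concise_slices_independent assms)
  then obtain G p q where *: "inj_on (\<lambda>s. (p s, q s)) {..<?N}"
    "\<And>s. s < ?N \<Longrightarrow> p s < ?N" "\<And>s. s < ?N \<Longrightarrow> q s < ?N"
    "\<And>s. s < ?N \<Longrightarrow> (\<Sum>l<?N. G s l * ?T l (p s) (q s)) \<noteq> 0"
    "\<And>s i j. s < ?N \<Longrightarrow> i < ?N \<Longrightarrow> j < ?N \<Longrightarrow> (\<Sum>l<?N. G s l * ?T l i j) \<noteq> 0 \<Longrightarrow>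
      p s * ?N + q s \<le> i * ?N + j"
    by (rule tensor_echelon_form) (rule that)
  interpret echelon_tensor n m T "\<lambda>s i j. \<Sum>l<?N. G s l * ?T l i j" p q ?N
  proof
    show "restriction {..<?N} ?T {..<?N} (\<lambda>s i j. \<Sum>l<?N. G s l * ?T l i j)"
      by (rule restriction_leg1) simp_all
  qed (use assms * in auto)
  show thesis using that by (rule subrank_lower_bound)
qed

section \<open>The asymptotic subrank\<close>

text \<open>Fekete's lemma in multiplicative form: the limit is the supremum of the roots over
  \<open>m > 0\<close>, finite by \<open>bound\<close>, which also gives the estimate by
  \<open>L ^ m\<close>.\<close>

lemma fekete_root:
  fixes a :: "nat \<Rightarrow> nat"
  assumes mult: "\<And>i j. a i * a j \<le> a (i + j)" and pos: "\<And>m. a m > 0"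
    and bound: "\<And>m. a m \<le> n ^ m"
  obtains L where "(\<lambda>m. root m (real (a m))) \<longlonglongrightarrow> L" and "\<And>m. real (a m) \<le> L ^ m"
proof -
  define R where "R = (\<lambda>m. root m (real (a m))) ` {0<..}"
  define L where "L = Sup R"
  have "bdd_above R"
  proof (rule bdd_aboveI)
    fix x assume "x \<in> R"
    then obtain m where m: "m > 0" "x = root m (real (a m))" by (auto simp: R_def)
    have "real (a m) \<le> real n ^ m" using bound[of m] by (simp flip: of_nat_power)
    then have "root m (real (a m)) \<le> root m (real n ^ m)" using m(1) by (rule real_root_le_mono[rotated])
    then show "x \<le> real n" using m by (simp add: real_root_power_cancel)
  qed
  then have le_L: "root m (real (a m)) \<le> L" if "m > 0" for m
    unfolding L_def using that by (intro cSup_upper) (auto simp: R_def)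
  have a_le: "real (a m) \<le> L ^ m" if "m > 0" for m
  proof -
    have "real (a m) = root m (real (a m)) ^ m" using that by (simp add: real_root_pow_pos2)
    also have "\<dots> \<le> L ^ m" using le_L[OF that] by (intro power_mono) (auto simp: real_root_ge_zero)
    finally show ?thesis .
  qed
  have mult_pow: "a k ^ t \<le> a (t * k)" if "t > 0" for k t
    using that
  proof (induction t rule: nat_induct_non_zero)
    case (Suc t)
    have "a k ^ Suc t \<le> a k * a (t * k)" using Suc.IH by simp
    also have "\<dots> \<le> a (Suc t * k)" using mult[of k "t * k"] by simp
    finally show ?case .
  qed simp
  \<comment> \<open>Write \<open>m = t * k + m mod k\<close> and drop the factor
    \<open>a (m mod k)\<close>, which is at least \<open>1\<close>; then compare
    \<open>t / m\<close> with \<open>1 / k\<close>.\<close>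
  have lower: "root k (real (a k)) powr (1 - real k / real m) \<le> root m (real (a m))"
    if "k > 0" "m \<ge> k" for k m
  proof -
    define t where "t = m div k"
    have m: "m > 0" "m = t * k + m mod k" using that by (simp_all add: t_def)
    have "t > 0" using that by (simp add: t_def div_greater_zero_iff)
    have "a k ^ t * 1 \<le> a (t * k) * a (m mod k)"
      using mult_pow[OF \<open>t > 0\<close>] pos by (intro mult_le_mono) (auto simp: Suc_le_eq)
    also have "\<dots> \<le> a m" using mult[of "t * k" "m mod k"] m(2) by simp
    finally have at: "real (a k) ^ t \<le> real (a m)" by (simp flip: of_nat_power)
    have ak: "1 \<le> real (a k)" using pos[of k] by simp
    have "real m < real (t * k) + real k"
      using m(2) mod_less_divisor[OF that(1), of m] by linarith
    then have "real m - real k \<le> real t * real k" by simp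
    have ex: "(1 - real k / real m) / real k \<le> real t / real m"
    proof -
      have "(1 - real k / real m) / real k = (real m - real k) / (real k * real m)"
        using that m(1) by (simp add: field_simps)
      also have "\<dots> \<le> (real t * real k) / (real k * real m)"
        using \<open>real m - real k \<le> real t * real k\<close> by (intro divide_right_mono) auto
      finally show ?thesis using that by simp
    qed
    have "root k (real (a k)) powr (1 - real k / real m) = real (a k) powr ((1 - real k / real m) / real k)"
      using that ak by (simp add: root_powr_inverse powr_powr)
    also have "\<dots> \<le> real (a k) powr (real t / real m)"
      using ex ak by (intro powr_mono) auto
    also have "\<dots> = root m (real (a k) ^ t)"
      using m(1) ak by (simp add: root_powr_inverse powr_powr flip: powr_realpow)
    also have "\<dots> \<le> root m (real (a m))"
      using at m(1) by (intro real_root_le_mono) auto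
    finally show ?thesis .
  qed
  have lim: "(\<lambda>m. root m (real (a m))) \<longlonglongrightarrow> L"
  proof (rule order_tendstoI)
    fix y assume "y < L"
    then obtain k where k: "k > 0" "y < root k (real (a k))"
      using less_cSup_iff[of R y] \<open>bdd_above R\<close> by (auto simp: R_def L_def)
    have "root k (real (a k)) > 0" using k(1) pos[of k] by simp
    moreover have "(\<lambda>m. 1 - real k / real m) \<longlonglongrightarrow> 1 - 0"
      by (intro tendsto_intros lim_const_over_n)
    ultimately have "(\<lambda>m. root k (real (a k)) powr (1 - real k / real m)) \<longlonglongrightarrow> root k (real (a k)) powr (1 - 0)"
      by (intro tendsto_powr tendsto_const) auto
    then have "\<forall>\<^sub>F m in sequentially. y < root k (real (a k)) powr (1 - real k / real m)"
      using k(2) \<open>root k (real (a k)) > 0\<close> by (intro order_tendstoD(1)) simp_all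
    with eventually_ge_at_top[of k] show "\<forall>\<^sub>F m in sequentially. y < root m (real (a m))"
    proof eventually_elim
      case (elim m)
      then show ?case using lower[OF k(1), of m] by linarith
    qed
  next
    fix y assume "L < y"
    show "\<forall>\<^sub>F m in sequentially. root m (real (a m)) < y"
      using eventually_gt_at_top[of 0]
    proof eventually_elim
      case (elim m)
      then show ?case using le_L[of m] \<open>L < y\<close> by linarith
    qed
  qed
  \<comment> \<open>The supremum covers only \<open>m > 0\<close>.\<close>
  have "a 0 = 1" using bound[of 0] pos[of 0] by simp
  then have "real (a m) \<le> L ^ m" for m
    using a_le by (cases "m = 0") auto
  with lim show thesis by (rule that)
qed

text \<open>Take \<open>K\<close>-th roots: \<open>K + 1 \<le> 2 * K\<close> for
  \<open>K \<ge> 1\<close>, and the \<open>K\<close>-th roots of \<open>2\<close> and of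
  \<open>K\<close> tend to \<open>1\<close>.\<close>

lemma le_if_power_le_polynomial:
  fixes x y :: real
  assumes "y > 0" and "\<And>K. x ^ K \<le> y ^ K * real (K + 1) ^ C"
  shows "x \<le> y"
proof (cases "x > 0")
  case True
  have "x / y \<le> (root K 2 * root K (real K)) ^ C" if "K \<ge> 1" for K
  proof -
    have "(x / y) ^ K \<le> real (K + 1) ^ C"
      using assms by (simp add: power_divide field_simps)
    also have "\<dots> \<le> (2 * real K) ^ C" using that by (intro power_mono) auto
    finally have "root K ((x / y) ^ K) \<le> root K ((2 * real K) ^ C)"
      using that by (intro real_root_le_mono) auto
    then show ?thesis
      using that True assms(1) by (simp add: real_root_power_cancel real_root_power real_root_mult
          power_mult_distrib)
  qed
  moreover have "(\<lambda>K. (root K 2 * root K (real K)) ^ C) \<longlonglongrightarrow> (1 * 1) ^ C"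
    by (intro tendsto_intros LIMSEQ_root LIMSEQ_root_const) simp
  ultimately have "x / y \<le> (1 * 1) ^ C"
    using LIMSEQ_le_const by blast
  then show ?thesis using assms(1) by (simp add: field_simps)
qed (use assms(1) in simp)

lemma subrank_pos:
  assumes "i < n" "j < n" "k < n" and "T i j k \<noteq> 0"
  shows "subrank n T \<ge> 1"
proof -
  have "restriction {..<n} T {..<1} unit_tensor"
    by (rule restriction_select[where f = "\<lambda>_. i" and g = "\<lambda>_. j" and h = "\<lambda>_. k"
          and \<alpha> = "\<lambda>_. inverse (T i j k)"]) (use assms in \<open>auto simp: unit_tensor_def\<close>)
  then show ?thesis by (rule restriction_subrank)
qed

lemma subrank_kronecker_power_pos:
  assumes "slices_independent n T" and "n > 0"
  shows "subrank (n ^ m) (kronecker_power n T m) > 0"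
proof -
  have nm: "n ^ m > 0" using assms(2) by simp
  have "slices_independent (n ^ m) (kronecker_power n T m)"
    by (rule slices_independent_kronecker_power[OF assms(1)])
  \<comment> \<open>The all-ones combination of slices cannot vanish, so some entry is
    nonzero.\<close>
  then have "\<exists>j<n ^ m. \<exists>k<n ^ m. (\<Sum>l<n ^ m. 1 * kronecker_power n T m l j k) \<noteq> 0"
    using nm unfolding slices_independent_def by (force dest: spec[of _ "\<lambda>_. 1"])
  then obtain l j k where "l < n ^ m" "j < n ^ m" "k < n ^ m" "kronecker_power n T m l j k \<noteq> 0"
    by (auto elim: sum.not_neutral_contains_not_neutral)
  then have "subrank (n ^ m) (kronecker_power n T m) \<ge> 1" by (rule subrank_pos)
  then show ?thesis by simp
qed

theorem theorem5p16:
  fixes T :: "'a::field tensor3" and n :: nat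
  assumes "symmetric_tensor n T" and "concise n T"
  shows "convergent (subrank_root_seq n T) \<and> asymptotic_subrank n T \<ge> sqrt (real n)"
proof (cases "n = 0")
  case True
  \<comment> \<open>For \<open>m > 0\<close> the dimension is \<open>0\<close>; for
    \<open>m = 0\<close> it is \<open>1\<close>, but \<open>root 0\<close> is constantly
    \<open>0\<close>.\<close>
  have "subrank_root_seq n T m = 0" for m
  proof (cases "m = 0")
    case False
    have "subrank (n ^ m) (kronecker_power n T m) \<le> n ^ m"
      using restricts_to_unit_subrank restricts_to_unit_le by blast
    then show ?thesis using \<open>n = 0\<close> False by (simp add: subrank_root_seq_def power_0_left)
  qed (simp add: subrank_root_seq_def)
  then have "subrank_root_seq n T = (\<lambda>_. 0)" by blast
  then show ?thesis using True by (simp add: asymptotic_subrank_def convergent_const)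
next
  case False
  let ?a = "\<lambda>m. subrank (n ^ m) (kronecker_power n T m)"
  have pos: "?a m > 0" for m
    using False assms(2) by (intro subrank_kronecker_power_pos concise_slices_independent) simp_all
  obtain L where lim: "(\<lambda>m. root m (real (?a m))) \<longlonglongrightarrow> L" and le: "\<And>m. real (?a m) \<le> L ^ m"
  proof (rule fekete_root[of ?a n])
    show "?a m \<le> n ^ m" for m
      using restricts_to_unit_subrank restricts_to_unit_le by blast
  qed (use pos subrank_kronecker_power_add in auto)
  have "L \<ge> 1" using le[of 1] pos[of 1] by simp
  have "sqrt (real n) \<le> L"
  proof (rule ccontr)
    assume "\<not> sqrt (real n) \<le> L"
    then have "1 < sqrt (real n) / L" using \<open>L \<ge> 1\<close> by (simp add: field_simps)
    \<comment> \<open>A ratio above \<open>1\<close> outgrows the constant \<open>72\<close>, while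
      the lower bound at some \<open>k \<ge> m\<close> keeps its \<open>k\<close>-th power at most
      \<open>72\<close>.\<close>
    then obtain m where m: "72 < (sqrt (real n) / L) ^ m"
      using real_arch_pow by blast
    obtain k z C where k: "m \<le> k" and z: "n ^ k \<le> 5184 * z ^ 2"
      and zK: "\<And>K. z ^ K \<le> ?a (K * k) * (K + 1) ^ C"
      using subrank_kronecker_power_lower_bound[OF assms, of m] False by blast
    \<comment> \<open>Letting \<open>K\<close> grow removes the polynomial factor.\<close>
    have "real z \<le> L ^ k"
    proof (rule le_if_power_le_polynomial)
      fix K
      have "real z ^ K \<le> real (?a (K * k)) * real (K + 1) ^ C"
        using of_nat_mono[OF zK[of K], where 'a = real] by simp
      also have "\<dots> \<le> L ^ (K * k) * real (K + 1) ^ C"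
        using le by (intro mult_right_mono) auto
      finally show "real z ^ K \<le> (L ^ k) ^ K * real (K + 1) ^ C"
        by (simp add: power_mult mult.commute[of K k])
    qed (use \<open>L \<ge> 1\<close> in simp)
    have "(sqrt (real n) ^ k) ^ 2 = (sqrt (real n) ^ 2) ^ k"
      by (simp only: power_mult[symmetric] mult.commute)
    also have "\<dots> = real (n ^ k)" by simp
    also have "\<dots> \<le> (72 * real z) ^ 2"
      using z by (simp add: power_mult_distrib flip: of_nat_power)
    finally have "sqrt (real n) ^ k \<le> 72 * real z"
      by (rule power2_le_imp_le) simp
    also have "\<dots> \<le> 72 * L ^ k" using \<open>real z \<le> L ^ k\<close> by simp
    finally have "(sqrt (real n) / L) ^ k \<le> 72"
      using \<open>L \<ge> 1\<close> by (simp add: power_divide field_simps)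
    moreover have "(sqrt (real n) / L) ^ m \<le> (sqrt (real n) / L) ^ k"
      using k \<open>1 < sqrt (real n) / L\<close> by (intro power_increasing) auto
    ultimately show False using m by linarith
  qed
  moreover have "subrank_root_seq n T \<longlonglongrightarrow> L"
    using lim by (simp add: subrank_root_seq_def[abs_def])
  ultimately show ?thesis
    unfolding asymptotic_subrank_def using convergentI limI by blast
qed

end
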